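(* Let $(M,g)$ be a connected closed Riemannian manifold, let $f\in C^\infty(M)$ be a positive function and let $k\ge1$ be an integer. Then every $f$-$k$-harmonic function $u:M\to\mathbb{R}$ is constant.
   Context: Closed means compact without boundary. $\Delta=\operatorname{div}\nabla$ is the Laplace–Beltrami operator on functions. For an integer $k\ge1$ and a smooth positive function $f$, a smooth function $u:M\to\mathbb{R}$ is called $f$-$k$-harmonic if, with $s=\lfloor k/2\rfloor$, $$\Delta^s(f\,\Delta^s u)=0\ \text{ when } k=2s,\qquad \Delta^s\big(\operatorname{div}(f\nabla\Delta^s u)\big)=0\ \text{ when } k=2s+1 .$$ (This is the Euler–Lagrange equation of $\frac12\int f|\Delta^su|^2$, respectively $\frac12\int f|\nabla\Delta^su|^2$.) *)

theory Defs
  imports "HOL-Analysis.Analysis"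
begin

section \<open>Smooth maps between open subsets of normed spaces\<close>

text \<open>
  \<open>C_diff_on r S F\<close> is the class \<open>C\<^sup>r\<close> on \<open>S\<close>, phrased with iterated directional derivatives.
  It is only meant for open \<open>S\<close>.
\<close>

primrec C_diff_on ::
  "nat \<Rightarrow> 'e::real_normed_vector set \<Rightarrow> ('e \<Rightarrow> 'f::real_normed_vector) \<Rightarrow> bool" where
  "C_diff_on 0 S F \<longleftrightarrow> continuous_on S F"
| "C_diff_on (Suc r) S F \<longleftrightarrow>
     (\<forall>x\<in>S. F differentiable (at x)) \<and>
     (\<forall>v. C_diff_on r S (\<lambda>x. frechet_derivative F (at x) v))"

definition smooth_on ::
  "'e::real_normed_vector set \<Rightarrow> ('e \<Rightarrow> 'f::real_normed_vector) \<Rightarrow> bool" where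
  "smooth_on S F \<longleftrightarrow> (\<forall>r. C_diff_on r S F)"

definition pderiv_at :: "'n::finite \<Rightarrow> (real^'n \<Rightarrow> real) \<Rightarrow> real^'n \<Rightarrow> real" where
  "pderiv_at i F x = frechet_derivative F (at x) (axis i 1)"


section \<open>Smooth manifolds\<close>

text \<open>
  A chart is a pair of its domain and its coordinate map; the values of the coordinate map outside
  the domain are irrelevant. Charts are onto open subsets of \<open>real^'n\<close>, so there is no boundary, and
  the dimension is \<open>CARD('n)\<close>.
\<close>

type_synonym ('a, 'n) chart = "'a set \<times> ('a \<Rightarrow> real^'n)"

abbreviation chart_dom :: "('a, 'n::finite) chart \<Rightarrow> 'a set" where
  "chart_dom c \<equiv> fst c"

abbreviation chart_map :: "('a, 'n::finite) chart \<Rightarrow> 'a \<Rightarrow> real^'n" where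
  "chart_map c \<equiv> snd c"

abbreviation chart_img :: "('a, 'n::finite) chart \<Rightarrow> (real^'n) set" where
  "chart_img c \<equiv> chart_map c ` chart_dom c"

definition chart_inv :: "('a, 'n::finite) chart \<Rightarrow> real^'n \<Rightarrow> 'a" where
  "chart_inv c = inv_into (chart_dom c) (chart_map c)"

definition transition ::
  "('a, 'n::finite) chart \<Rightarrow> ('a, 'n) chart \<Rightarrow> real^'n \<Rightarrow> real^'n" where
  "transition c d = chart_map d \<circ> chart_inv c"

locale smooth_manifold =
  fixes M :: "'a topology" and A :: "('a, 'n::finite) chart set"
  assumes hausdorff: "Hausdorff_space M"
    and second_countable: "second_countable M"
    and charts_cover: "topspace M = (\<Union>c\<in>A. chart_dom c)"
    and open_dom: "c \<in> A \<Longrightarrow> openin M (chart_dom c)"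
    and open_img: "c \<in> A \<Longrightarrow> open (chart_img c)"
    and chart_homeomorphic:
      "c \<in> A \<Longrightarrow> homeomorphic_map (subtopology M (chart_dom c)) (top_of_set (chart_img c)) (chart_map c)"
    and smooth_transition:
      "c \<in> A \<Longrightarrow> d \<in> A \<Longrightarrow>
        smooth_on (chart_map c ` (chart_dom c \<inter> chart_dom d)) (transition c d)"

definition smooth_fun :: "('a, 'n::finite) chart set \<Rightarrow> ('a \<Rightarrow> real) \<Rightarrow> bool" where
  "smooth_fun A u \<longleftrightarrow> (\<forall>c\<in>A. smooth_on (chart_img c) (u \<circ> chart_inv c))"

definition charts_at :: "('a, 'n::finite) chart set \<Rightarrow> 'a \<Rightarrow> ('a, 'n) chart set" where
  "charts_at A p = {c \<in> A. p \<in> chart_dom c}"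

text \<open>
  An arbitrary chart around \<open>p\<close>, used to evaluate expressions that do not depend on
  the choice of the chart.
\<close>

definition chart_at :: "('a, 'n::finite) chart set \<Rightarrow> 'a \<Rightarrow> ('a, 'n) chart" where
  "chart_at A p = (SOME c. c \<in> charts_at A p)"


section \<open>Tangent vectors\<close>

text \<open>
  A tangent vector at \<open>p\<close> assigns to each chart around \<open>p\<close> its coordinates, compatibly with the
  Jacobians of the transition maps. Coordinates in all other charts are set to \<open>0\<close>, so that equality
  of tangent vectors is equality of functions. The vector space operations are pointwise.
\<close>

type_synonym ('a, 'n) tangent = "('a, 'n) chart \<Rightarrow> real^'n"

definition tangent_space :: "('a, 'n::finite) chart set \<Rightarrow> 'a \<Rightarrow> ('a, 'n) tangent set" where
  "tangent_space A p =
     {v. (\<forall>c. c \<notin> charts_at A p \<longrightarrow> v c = 0) \<and>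
         (\<forall>c\<in>charts_at A p. \<forall>d\<in>charts_at A p.
            v d = frechet_derivative (transition c d) (at (chart_map c p)) (v c))}"

definition coord_vec ::
  "('a, 'n::finite) chart set \<Rightarrow> ('a, 'n) chart \<Rightarrow> 'n \<Rightarrow> 'a \<Rightarrow> ('a, 'n) tangent" where
  "coord_vec A c i p =
     (\<lambda>d. if d \<in> charts_at A p
          then frechet_derivative (transition c d) (at (chart_map c p)) (axis i 1) else 0)"

text \<open>The differential \<open>du\<^sub>p(w)\<close>.\<close>

definition differential ::
  "('a, 'n::finite) chart set \<Rightarrow> ('a \<Rightarrow> real) \<Rightarrow> 'a \<Rightarrow> ('a, 'n) tangent \<Rightarrow> real" where
  "differential A u p w =
     (let c = chart_at A p
      in frechet_derivative (u \<circ> chart_inv c) (at (chart_map c p)) (w c))"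


section \<open>Riemannian metrics\<close>

type_synonym ('a, 'n) metric = "'a \<Rightarrow> ('a, 'n) tangent \<Rightarrow> ('a, 'n) tangent \<Rightarrow> real"

text \<open>The matrix \<open>g\<^sub>i\<^sub>j\<close> of the metric in the chart \<open>c\<close>, as a function of the coordinates.\<close>

definition metric_matrix ::
  "('a, 'n::finite) chart set \<Rightarrow> ('a, 'n) metric \<Rightarrow> ('a, 'n) chart \<Rightarrow> real^'n \<Rightarrow> real^'n^'n" where
  "metric_matrix A g c x =
     (let p = chart_inv c x in \<chi> i j. g p (coord_vec A c i p) (coord_vec A c j p))"

locale riemannian_manifold = smooth_manifold M A
  for M :: "'a topology" and A :: "('a, 'n::finite) chart set" +
  fixes g :: "('a, 'n) metric"
  assumes metric_linear:
      "p \<in> topspace M \<Longrightarrow> v \<in> tangent_space A p \<Longrightarrow> v' \<in> tangent_space A p \<Longrightarrow>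
       w \<in> tangent_space A p \<Longrightarrow>
         g p (\<lambda>c. a *\<^sub>R v c + b *\<^sub>R v' c) w = a * g p v w + b * g p v' w"
    and metric_sym:
      "p \<in> topspace M \<Longrightarrow> v \<in> tangent_space A p \<Longrightarrow> w \<in> tangent_space A p \<Longrightarrow> g p v w = g p w v"
    and metric_pos:
      "p \<in> topspace M \<Longrightarrow> v \<in> tangent_space A p \<Longrightarrow> v \<noteq> (\<lambda>c. 0) \<Longrightarrow> g p v v > 0"
    and metric_smooth:
      "c \<in> A \<Longrightarrow> smooth_on (chart_img c) (\<lambda>x. metric_matrix A g c x $ i $ j)"

text \<open>The Christoffel symbols \<open>\<Gamma>\<^sup>i\<^sub>j\<^sub>k\<close> of the Levi-Civita connection in the chart \<open>c\<close>.\<close>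

definition christoffel ::
  "('a, 'n::finite) chart set \<Rightarrow> ('a, 'n) metric \<Rightarrow> ('a, 'n) chart \<Rightarrow> 'n \<Rightarrow> 'n \<Rightarrow> 'n \<Rightarrow> real^'n \<Rightarrow> real"
  where
  "christoffel A g c i j k x =
     (\<Sum>l\<in>UNIV. matrix_inv (metric_matrix A g c x) $ i $ l *
        (pderiv_at j (\<lambda>y. metric_matrix A g c y $ k $ l) x
       + pderiv_at k (\<lambda>y. metric_matrix A g c y $ j $ l) x
       - pderiv_at l (\<lambda>y. metric_matrix A g c y $ j $ k) x)) / 2"


section \<open>Gradient, divergence, Laplace--Beltrami operator\<close>

type_synonym ('a, 'n) vector_field = "'a \<Rightarrow> ('a, 'n) tangent"

definition gradient ::
  "('a, 'n::finite) chart set \<Rightarrow> ('a, 'n) metric \<Rightarrow> ('a \<Rightarrow> real) \<Rightarrow> ('a, 'n) vector_field" where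
  "gradient A g u p =
     (THE v. v \<in> tangent_space A p \<and> (\<forall>w\<in>tangent_space A p. g p v w = differential A u p w))"

text \<open>The \<open>i\<close>-th component of \<open>\<nabla>\<^sub>j X\<close> in the chart \<open>c\<close>, where \<open>\<nabla>\<close> is the Levi-Civita connection.\<close>

definition cov_deriv ::
  "('a, 'n::finite) chart set \<Rightarrow> ('a, 'n) metric \<Rightarrow> ('a, 'n) chart \<Rightarrow> ('a, 'n) vector_field \<Rightarrow>
     'n \<Rightarrow> 'n \<Rightarrow> real^'n \<Rightarrow> real" where
  "cov_deriv A g c X i j x =
     pderiv_at j (\<lambda>y. X (chart_inv c y) c $ i) x
     + (\<Sum>k\<in>UNIV. christoffel A g c i j k x * X (chart_inv c x) c $ k)"

text \<open>\<open>div X\<close> is the trace of \<open>\<nabla>X\<close>.\<close>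

definition divergence ::
  "('a, 'n::finite) chart set \<Rightarrow> ('a, 'n) metric \<Rightarrow> ('a, 'n) vector_field \<Rightarrow> 'a \<Rightarrow> real" where
  "divergence A g X p =
     (let c = chart_at A p in \<Sum>i\<in>UNIV. cov_deriv A g c X i i (chart_map c p))"

definition laplacian ::
  "('a, 'n::finite) chart set \<Rightarrow> ('a, 'n) metric \<Rightarrow> ('a \<Rightarrow> real) \<Rightarrow> 'a \<Rightarrow> real" where
  "laplacian A g u = divergence A g (gradient A g u)"

definition scale_field :: "('a \<Rightarrow> real) \<Rightarrow> ('a, 'n::finite) vector_field \<Rightarrow> ('a, 'n) vector_field" where
  "scale_field f X = (\<lambda>p c. f p *\<^sub>R X p c)"


section \<open>f-k-harmonic functions\<close>

definition f_k_harmonic ::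
  "'a topology \<Rightarrow> ('a, 'n::finite) chart set \<Rightarrow> ('a, 'n) metric \<Rightarrow>
     ('a \<Rightarrow> real) \<Rightarrow> nat \<Rightarrow> ('a \<Rightarrow> real) \<Rightarrow> bool" where
  "f_k_harmonic M A g f k u \<longleftrightarrow>
     smooth_fun A u \<and>
     (let s = k div 2; \<Delta>s = (laplacian A g ^^ s)
      in \<forall>p\<in>topspace M.
           (if even k then \<Delta>s (\<lambda>q. f q * \<Delta>s u q) p = 0
            else \<Delta>s (divergence A g (scale_field f (gradient A g (\<Delta>s u)))) p = 0))"

end

(*
  For smooth f > 0 the operator L w = div (f grad w) is, in every chart, elliptic without zeroth-order
  term. By Hopf's strong maximum principle a function w with L w >= 0 everywhere (or L w <= 0
  everywhere) on a closed connected manifold is constant: the set where w attains its maximum is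
  closed, and it is open by the local principle. Taking f = 1 and removing one Laplacian at a time, a
  function is constant if one of its iterated Laplacians is. Let s = floor (k/2) and let v be the s-th
  iterated Laplacian of u. Then f v (k even) or L v (k odd) is constant. Hence v or L v has one sign,
  so that the (s-1)-st iterated Laplacian of u, respectively v, is constant, and so is u.
*)
theory Submission
  imports Defs
begin


section \<open>Calculus of smooth functions\<close>

text \<open>The classical proof multiplies by u and integrates by parts; the maximum principle
  replaces this by an argument inside single charts. The obstacle is then the form of
  \<open>divergence\<close>, which is evaluated at each point in a chart picked by
  \<open>SOME\<close>: neighbouring points may use unrelated charts, so neither the ellipticity of
  the operator near a point nor even the smoothness of \<open>laplacian A g u\<close> can be read
  off. Most of the work on the manifold shows that the trace of the covariant derivative is the same
  in all charts. The second derivatives of the transition maps enter there, and their symmetry makes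
  the correction terms cancel. Afterwards L is, in any fixed chart, one expression with smooth
  coefficients, and it can be iterated. A constant value of L w is never shown to be zero: its sign,
  whichever it is, already lets the maximum principle act on w or on -w.\<close>

lemma C_diff_on_cong:
  assumes "open S" "\<And>x. x \<in> S \<Longrightarrow> F x = G x" "C_diff_on r S F"
  shows "C_diff_on r S G"
  using assms(2,3)
proof (induction r arbitrary: F G)
  case 0
  then show ?case
    by (simp cong: continuous_on_cong)
next
  case (Suc r)
  have eq: "frechet_derivative F (at x) = frechet_derivative G (at x)" if "x \<in> S" for x
    using Suc.prems that \<open>open S\<close> by (intro frechet_derivative_transform_within_open) auto
  have "G differentiable (at x)" if "x \<in> S" for x
    using Suc.prems that \<open>open S\<close> has_derivative_transform_within_open[of F _ x UNIV S G]
    unfolding differentiable_def by (metis C_diff_on.simps(2) frechet_derivative_works)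
  moreover have "C_diff_on r S (\<lambda>x. frechet_derivative G (at x) v)" for v
    by (rule Suc.IH[of "\<lambda>x. frechet_derivative F (at x) v"]) (use Suc.prems(2) eq in auto)
  ultimately show ?case
    by simp
qed

lemma C_diff_on_SucD: "C_diff_on (Suc r) S F \<Longrightarrow> C_diff_on r S F"
proof (induction r arbitrary: F)
  case 0
  then show ?case
    by (auto intro!: continuous_at_imp_continuous_on differentiable_imp_continuous_within)
next
  case (Suc r)
  from Suc.prems show ?case
    by (subst C_diff_on.simps) (auto simp del: C_diff_on.simps intro: Suc.IH simp: C_diff_on.simps(2)[of "Suc r"])
qed

lemma smooth_on_has_derivative:
  "smooth_on S F \<Longrightarrow> x \<in> S \<Longrightarrow> (F has_derivative frechet_derivative F (at x)) (at x)"
  unfolding smooth_on_def by (metis C_diff_on.simps(2) frechet_derivative_works)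

lemma smooth_on_frechet_derivative:
  "smooth_on S F \<Longrightarrow> smooth_on S (\<lambda>x. frechet_derivative F (at x) v)"
  unfolding smooth_on_def by (metis C_diff_on.simps(2))

lemma smooth_on_pderiv_at: "smooth_on S F \<Longrightarrow> smooth_on S (pderiv_at i F)"
  unfolding pderiv_at_def by (rule smooth_on_frechet_derivative)

lemma smooth_on_continuous_on: "smooth_on S F \<Longrightarrow> continuous_on S F"
  unfolding smooth_on_def by (metis C_diff_on.simps(1))

lemma smooth_on_cong:
  "open S \<Longrightarrow> smooth_on S F \<Longrightarrow> (\<And>x. x \<in> S \<Longrightarrow> F x = G x) \<Longrightarrow> smooth_on S G"
  unfolding smooth_on_def by (metis C_diff_on_cong)

section \<open>Closure of the classes C^r under algebraic operations\<close>

lemma C_diff_on_const: "C_diff_on r S (\<lambda>x. c)"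
  by (induction r arbitrary: c) auto

lemma smooth_on_const: "smooth_on S (\<lambda>x. c)"
  by (simp add: smooth_on_def C_diff_on_const)

text \<open>Derivatives are unique, so any derivative \<open>F'\<close> that a differentiation rule
  produces may stand for \<open>frechet_derivative\<close>. Each closure property below becomes an
  induction on \<open>r\<close> over the corresponding rule.\<close>

lemma C_diff_on_SucI:
  assumes "open S" "\<And>x. x \<in> S \<Longrightarrow> (F has_derivative F' x) (at x)"
    and "\<And>v. C_diff_on r S (\<lambda>x. F' x v)"
  shows "C_diff_on (Suc r) S F"
proof -
  have "frechet_derivative F (at x) = F' x" if "x \<in> S" for x
    using assms(2)[OF that] frechet_derivative_at by metis
  then show ?thesis
    using assms by (auto simp: differentiable_def intro: C_diff_on_cong[OF assms(1) _ assms(3)])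
qed

lemma C_diff_on_Suc_has_derivative:
  "C_diff_on (Suc r) S F \<Longrightarrow> x \<in> S \<Longrightarrow> (F has_derivative frechet_derivative F (at x)) (at x)"
  by (simp add: frechet_derivative_works)

lemma C_diff_on_add:
  "open S \<Longrightarrow> C_diff_on r S F \<Longrightarrow> C_diff_on r S G \<Longrightarrow> C_diff_on r S (\<lambda>x. F x + G x)"
proof (induction r arbitrary: F G)
  case (Suc r)
  show ?case
    by (rule C_diff_on_SucI[OF \<open>open S\<close> has_derivative_add[OF C_diff_on_Suc_has_derivative[OF Suc.prems(2)]
          C_diff_on_Suc_has_derivative[OF Suc.prems(3)]] Suc.IH[OF \<open>open S\<close>]])
       (use Suc.prems in auto)
qed (auto intro: continuous_on_add)

lemma C_diff_on_mult:
  fixes F G :: "'e::real_normed_vector \<Rightarrow> real"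
  shows "open S \<Longrightarrow> C_diff_on r S F \<Longrightarrow> C_diff_on r S G \<Longrightarrow> C_diff_on r S (\<lambda>x. F x * G x)"
proof (induction r arbitrary: F G)
  case (Suc r)
  show ?case
    by (rule C_diff_on_SucI[OF \<open>open S\<close> has_derivative_mult[OF C_diff_on_Suc_has_derivative[OF Suc.prems(2)]
          C_diff_on_Suc_has_derivative[OF Suc.prems(3)]]])
       (use Suc.prems in \<open>auto intro!: C_diff_on_add Suc.IH C_diff_on_SucD[of r S F] C_diff_on_SucD[of r S G]\<close>)
qed (auto intro: continuous_on_mult)

lemma C_diff_on_bounded_linear:
  assumes "bounded_linear L"
  shows "open S \<Longrightarrow> C_diff_on r S F \<Longrightarrow> C_diff_on r S (\<lambda>x. L (F x))"
proof (induction r arbitrary: F)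
  case 0
  then show ?case
    using bounded_linear.continuous_on[OF assms] by simp
next
  case (Suc r)
  show ?case
    by (rule C_diff_on_SucI[OF \<open>open S\<close> bounded_linear.has_derivative[OF assms
          C_diff_on_Suc_has_derivative[OF Suc.prems(2)]] Suc.IH[OF \<open>open S\<close>]])
       (use Suc.prems in auto)
qed

text \<open>The derivative of 1/F is -(1/F) F' (1/F). It contains 1/F itself, but only its class
  \<open>C_diff_on r\<close> is required, which is the induction hypothesis.\<close>

lemma C_diff_on_inverse:
  fixes F :: "'e::real_normed_vector \<Rightarrow> real"
  assumes "open S" "\<And>x. x \<in> S \<Longrightarrow> F x \<noteq> 0"
  shows "C_diff_on r S F \<Longrightarrow> C_diff_on r S (\<lambda>x. inverse (F x))"
proof (induction r)
  case (Suc r)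
  have "C_diff_on r S (\<lambda>x. inverse (F x))"
    using Suc C_diff_on_SucD by blast
  moreover have "C_diff_on r S (\<lambda>x. - frechet_derivative F (at x) v)" for v
    using Suc.prems assms(1) by (intro C_diff_on_bounded_linear[OF bounded_linear_minus[OF bounded_linear_ident]]) auto
  ultimately have "C_diff_on r S (\<lambda>x. - (inverse (F x) * frechet_derivative F (at x) v * inverse (F x)))" for v
    using C_diff_on_mult[OF assms(1) C_diff_on_mult[OF assms(1)], of r "\<lambda>x. inverse (F x)"
        "\<lambda>x. - frechet_derivative F (at x) v" "\<lambda>x. inverse (F x)"] by simp
  then show ?case
    by (intro C_diff_on_SucI[OF \<open>open S\<close> Deriv.has_derivative_inverse[OF assms(2) C_diff_on_Suc_has_derivative[OF Suc.prems]]])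
qed (use assms in \<open>auto intro: continuous_on_inverse\<close>)

lemma smooth_on_add: "open S \<Longrightarrow> smooth_on S F \<Longrightarrow> smooth_on S G \<Longrightarrow> smooth_on S (\<lambda>x. F x + G x)"
  by (simp add: smooth_on_def C_diff_on_add)

lemma smooth_on_mult:
  fixes F G :: "'e::real_normed_vector \<Rightarrow> real"
  shows "open S \<Longrightarrow> smooth_on S F \<Longrightarrow> smooth_on S G \<Longrightarrow> smooth_on S (\<lambda>x. F x * G x)"
  by (simp add: smooth_on_def C_diff_on_mult)

lemma smooth_on_bounded_linear:
  "bounded_linear L \<Longrightarrow> open S \<Longrightarrow> smooth_on S F \<Longrightarrow> smooth_on S (\<lambda>x. L (F x))"
  by (simp add: smooth_on_def C_diff_on_bounded_linear)

lemma smooth_on_divide: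
  fixes F G :: "'e::real_normed_vector \<Rightarrow> real"
  assumes "open S" "smooth_on S F" "smooth_on S G" "\<And>x. x \<in> S \<Longrightarrow> G x \<noteq> 0"
  shows "smooth_on S (\<lambda>x. F x / G x)"
  using assms unfolding divide_inverse smooth_on_def
  by (auto intro!: C_diff_on_mult C_diff_on_inverse)

lemma smooth_on_sum:
  "open S \<Longrightarrow> (\<And>i. i \<in> I \<Longrightarrow> smooth_on S (F i)) \<Longrightarrow> smooth_on S (\<lambda>x. \<Sum>i\<in>I. F i x)"
  by (induction I rule: infinite_finite_induct) (auto intro: smooth_on_const smooth_on_add)

lemma smooth_on_prod:
  fixes F :: "'i \<Rightarrow> 'e::real_normed_vector \<Rightarrow> real"
  shows "open S \<Longrightarrow> (\<And>i. i \<in> I \<Longrightarrow> smooth_on S (F i)) \<Longrightarrow> smooth_on S (\<lambda>x. \<Prod>i\<in>I. F i x)"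
  by (induction I rule: infinite_finite_induct) (auto intro: smooth_on_const smooth_on_mult)

section \<open>Partial derivatives, determinants and inverse matrices\<close>

lemma has_derivative_pderiv_at:
  fixes F :: "real^'n::finite \<Rightarrow> real"
  assumes "(F has_derivative F') (at x)"
  shows "F' v = (\<Sum>i\<in>UNIV. v $ i * pderiv_at i F x)" and "pderiv_at i F x = F' (axis i 1)"
proof -
  show *: "pderiv_at i F x = F' (axis i 1)" for i
    unfolding pderiv_at_def using frechet_derivative_at[OF assms] by metis
  have "F' v = F' (\<Sum>i\<in>UNIV. v $ i *\<^sub>R axis i 1)"
    by (metis (no_types, lifting) basis_expansion scalar_mult_eq_scaleR sum.cong)
  also have "\<dots> = (\<Sum>i\<in>UNIV. v $ i *\<^sub>R F' (axis i 1))"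
    using has_derivative_linear[OF assms] by (simp add: linear_sum linear_cmul)
  finally show "F' v = (\<Sum>i\<in>UNIV. v $ i * pderiv_at i F x)"
    by (simp add: *)
qed

lemma pderiv_at_cong:
  assumes "open S" "x \<in> S" "\<And>y. y \<in> S \<Longrightarrow> F y = G y" "F differentiable (at x)"
  shows "pderiv_at i F x = pderiv_at i G x"
  unfolding pderiv_at_def using frechet_derivative_transform_within_open assms by metis

lemma smooth_on_det:
  fixes G :: "'e::real_normed_vector \<Rightarrow> real^'n::finite^'n"
  assumes "open S" "\<And>i j. smooth_on S (\<lambda>x. G x $ i $ j)"
  shows "smooth_on S (\<lambda>x. det (G x))"
  unfolding det_def using assms
  by (intro smooth_on_sum smooth_on_mult smooth_on_const smooth_on_prod) auto

lemma matrix_inv_mult: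
  assumes "invertible A"
  shows "A ** matrix_inv A = mat 1" "matrix_inv A ** A = mat 1"
  using someI_ex[OF assms[unfolded invertible_def]] unfolding matrix_inv_def by auto

text \<open>Column \<open>j\<close> of the inverse solves \<open>A *v x = axis j 1\<close>, so
  Cramer's rule applies. Quotients of determinants are what carries smoothness from the metric to
  the inverse metric.\<close>

lemma matrix_inv_cramer:
  fixes A :: "real^'n::finite^'n"
  assumes "invertible A"
  shows "matrix_inv A $ i $ j =
    det (\<chi> k l. if l = i then (if k = j then 1 else 0) else A $ k $ l) / det A"
proof -
  have "A *v column j (matrix_inv A) = axis j 1"
    using matrix_inv_mult(1)[OF assms]
    by (metis matrix_vector_mul_assoc matrix_vector_mul_lid matrix_vector_mult_basis)
  then have "column j (matrix_inv A) = (\<chi> i. det (\<chi> k l. if l = i then axis j 1 $ k else A $ k $ l) / det A)"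
    using cramer assms invertible_det_nz by blast
  then show ?thesis
    by (auto simp: column_def vec_eq_iff axis_def intro!: arg_cong2[where f="(/)"] arg_cong[where f=det])
qed

lemma smooth_on_matrix_inv:
  fixes G :: "'e::real_normed_vector \<Rightarrow> real^'n::finite^'n"
  assumes "open S" "\<And>i j. smooth_on S (\<lambda>x. G x $ i $ j)" "\<And>x. x \<in> S \<Longrightarrow> invertible (G x)"
  shows "smooth_on S (\<lambda>x. matrix_inv (G x) $ i $ j)"
proof -
  have "smooth_on S (\<lambda>x. (\<chi> k l. if l = i then (if k = j then 1 else 0) else G x $ k $ l) $ k $ l)" for k l
    using assms by (cases "l = i") (auto intro: smooth_on_const)
  then have "smooth_on S (\<lambda>x. det (\<chi> k l. if l = i then (if k = j then 1 else 0) else G x $ k $ l) / det (G x))"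
    using assms by (intro smooth_on_divide smooth_on_det) (auto simp: invertible_det_nz)
  then show ?thesis
    by (rule smooth_on_cong[OF assms(1)]) (simp add: matrix_inv_cramer assms(3))
qed


section \<open>The strong maximum principle\<close>

text \<open>As a polynomial in \<open>t\<close> this serves a semidefinite form twice: if
  \<open>a k k = 0\<close>, the linear term must vanish, and otherwise minimising over
  \<open>t\<close> yields the Schur complement.\<close>

lemma quadratic_form_add_axis:
  fixes a :: "'n::finite \<Rightarrow> 'n \<Rightarrow> real"
  assumes sym: "\<And>i j. a i j = a j i"
  shows "(\<Sum>i\<in>UNIV. \<Sum>j\<in>UNIV. a i j * (x i + (if i = k then t else 0)) * (x j + (if j = k then t else 0)))
    = (\<Sum>i\<in>UNIV. \<Sum>j\<in>UNIV. a i j * x i * x j) + 2 * t * (\<Sum>i\<in>UNIV. a k i * x i) + t\<^sup>2 * a k k"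
proof -
  have "(\<Sum>j\<in>UNIV. a i j * (x i + (if i = k then t else 0)) * (x j + (if j = k then t else 0)))
     = (\<Sum>j\<in>UNIV. a i j * x i * x j) + (if i = k then t * (\<Sum>j\<in>UNIV. a i j * x j) else 0)
       + t * (a i k * x i) + (if i = k then t\<^sup>2 * a i k else 0)" for i
  proof -
    have "(\<Sum>j\<in>UNIV. a i j * (x i + (if i = k then t else 0)) * (x j + (if j = k then t else 0)))
       = (\<Sum>j\<in>UNIV. a i j * x i * x j + (if i = k then t * (a i j * x j) else 0)
         + (if j = k then t * (a i j * x i) + (if i = k then t\<^sup>2 * a i j else 0) else 0))"
      by (intro sum.cong refl) (auto simp: algebra_simps power2_eq_square)
    then show ?thesis
      by (auto simp: sum.distrib sum_distrib_left)
  qed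
  moreover have "(\<Sum>i\<in>UNIV. a i k * x i) = (\<Sum>i\<in>UNIV. a k i * x i)"
    by (intro sum.cong refl) (metis sym)
  ultimately show ?thesis
    by (simp add: sum.distrib sum_distrib_left[symmetric])
qed

text \<open>
  Schur complements reduce the support of \<open>a\<close> one index at a time, splitting off a rank-one form
  \<open>a\<^sub>k a\<^sub>k\<^sup>T / a\<^sub>k\<^sub>k\<close> whose product with \<open>H\<close> is a value of the quadratic form of \<open>H\<close>.
\<close>

lemma semidefinite_sum_mult_nonpos:
  fixes a H :: "'n::finite \<Rightarrow> 'n \<Rightarrow> real"
  assumes sym: "\<And>i j. a i j = a j i"
    and psd: "\<And>x. 0 \<le> (\<Sum>i\<in>UNIV. \<Sum>j\<in>UNIV. a i j * x i * x j)"
    and nsd: "\<And>x. (\<Sum>i\<in>UNIV. \<Sum>j\<in>UNIV. H i j * x i * x j) \<le> 0"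
  shows "(\<Sum>i\<in>UNIV. \<Sum>j\<in>UNIV. a i j * H i j) \<le> 0"
proof -
  have "(\<Sum>i\<in>UNIV. \<Sum>j\<in>UNIV. a i j * H i j) \<le> 0"
    if "finite S" "\<And>i j. a i j \<noteq> 0 \<Longrightarrow> i \<in> S" "\<And>i j. a i j = a j i"
      "\<And>x. 0 \<le> (\<Sum>i\<in>UNIV. \<Sum>j\<in>UNIV. a i j * x i * x j)" for S a
    using that
  proof (induction S arbitrary: a rule: finite_induct)
    case empty
    then have "a i j = 0" for i j by blast
    then show ?case by simp
  next
    case (insert k S)
    note sym = insert.prems(2) and psd = insert.prems(3)
    have q: "0 \<le> (\<Sum>i\<in>UNIV. \<Sum>j\<in>UNIV. a i j * x i * x j) + 2 * t * (\<Sum>i\<in>UNIV. a k i * x i) + t\<^sup>2 * a k k" for x t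
      using psd[of "\<lambda>i. x i + (if i = k then t else 0)"] quadratic_form_add_axis[of a x k t, OF sym] by simp
    have axis: "(\<Sum>i\<in>UNIV. \<Sum>l\<in>UNIV. a i l * (if i = j then 1 else 0) * (if l = j then 1 else 0)) = a j j" for j
    proof -
      have "(\<Sum>i\<in>UNIV. \<Sum>l\<in>UNIV. a i l * (if i = j then 1 else 0) * (if l = j then 1 else 0))
        = (\<Sum>i\<in>UNIV. \<Sum>l\<in>UNIV. if l = j then if i = j then a i l else 0 else 0)"
        by (intro sum.cong refl) auto
      then show ?thesis by simp
    qed
    have qaxis: "0 \<le> a j j + 2 * t * a k j + t\<^sup>2 * a k k" for j t
      using q[of "\<lambda>i. if i = j then 1 else 0" t] by (simp add: axis if_distrib[of "(*) _"] cong: if_cong)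
    have "a k k \<ge> 0"
      using psd[of "\<lambda>i. if i = k then 1 else 0"] by (simp add: axis)
    show ?case
    proof (cases "a k k = 0")
      case True
      \<comment> \<open>With \<open>a k k = 0\<close> the bound \<open>qaxis\<close> is affine in
        \<open>t\<close>; at the chosen \<open>t\<close> it would read 0 <= -1 if the slope were
        nonzero.\<close>
      have akj: "a k j = 0" for j
        using qaxis[of j "- (a j j + 1) / (2 * a k j)"] True by (cases "a k j = 0") (auto simp: field_simps)
      show ?thesis
      proof (rule insert.IH[OF _ sym psd])
        show "i \<in> S" if "a i j \<noteq> 0" for i j
          using insert.prems(1)[OF that] that akj by auto
      qed
    next
      case False
      with \<open>a k k \<ge> 0\<close> have pos: "a k k > 0" by simp
      define b where "b i j = a i j - a k i * a k j / a k k" for i j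
      have "(\<Sum>i\<in>UNIV. \<Sum>j\<in>UNIV. b i j * H i j) \<le> 0"
      proof (rule insert.IH)
        show "i \<in> S" if "b i j \<noteq> 0" for i j
        proof -
          have "i \<noteq> k" using that pos by (auto simp: b_def)
          moreover have "a i j \<noteq> 0 \<or> a i k \<noteq> 0" using that sym by (auto simp: b_def)
          ultimately show ?thesis using insert.prems(1) by blast
        qed
        show "b i j = b j i" for i j
          using sym by (simp add: b_def)
        show "0 \<le> (\<Sum>i\<in>UNIV. \<Sum>j\<in>UNIV. b i j * x i * x j)" for x
        proof -
          define s where "s = (\<Sum>i\<in>UNIV. a k i * x i)"
          have "(\<Sum>i\<in>UNIV. \<Sum>j\<in>UNIV. b i j * x i * x j)
              = (\<Sum>i\<in>UNIV. \<Sum>j\<in>UNIV. a i j * x i * x j) - s * s / a k k"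
            unfolding s_def sum_product sum_divide_distrib sum_subtractf[symmetric]
            by (intro sum.cong refl) (simp add: b_def algebra_simps)
          \<comment> \<open>\<open>t = - s / a k k\<close> minimises the polynomial in
            \<open>q\<close>; its minimal value is the form of \<open>b\<close> at
            \<open>x\<close>.\<close>
          also have "\<dots> = (\<Sum>i\<in>UNIV. \<Sum>j\<in>UNIV. a i j * x i * x j) + 2 * (- s / a k k) * s + (- s / a k k)\<^sup>2 * a k k"
            using pos by (simp add: power2_eq_square field_simps)
          also have "\<dots> \<ge> 0"
            unfolding s_def by (rule q)
          finally show ?thesis .
        qed
      qed
      moreover have "(\<Sum>i\<in>UNIV. \<Sum>j\<in>UNIV. a i j * H i j) = (\<Sum>i\<in>UNIV. \<Sum>j\<in>UNIV. b i j * H i j)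
          + (\<Sum>i\<in>UNIV. \<Sum>j\<in>UNIV. H i j * a k i * a k j) / a k k"
        unfolding sum_divide_distrib sum.distrib[symmetric]
        by (intro sum.cong refl) (simp add: b_def algebra_simps)
      ultimately show ?thesis
        using nsd[of "a k"] pos by (simp add: divide_nonpos_pos add_nonpos_nonpos)
    qed
  qed
  from this[of UNIV a] show ?thesis using sym psd by simp
qed

text \<open>On the line through \<open>p\<close> in direction \<open>e\<close> the first derivative
  vanishes at \<open>p\<close>. A positive second derivative would make the first one positive just
  after \<open>p\<close>, and F would exceed its maximum there.\<close>

lemma interior_max_second_derivative:
  fixes F :: "'e::real_normed_vector \<Rightarrow> real"
  assumes "open U" "p \<in> U" and F1: "\<And>x. x \<in> U \<Longrightarrow> (F has_derivative F1 x) (at x)"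
    and F2: "((\<lambda>x. F1 x e) has_derivative F2) (at p)"
    and max: "\<And>x. x \<in> U \<Longrightarrow> F x \<le> F p"
  shows "F2 e \<le> 0"
proof (rule ccontr)
  assume "\<not> F2 e \<le> 0"
  define l where "l t = p + t *\<^sub>R e" for t :: real
  have l': "(l has_derivative (\<lambda>h. h *\<^sub>R e)) (at t)" for t
    unfolding l_def by (auto intro!: derivative_eq_intros)
  have "open (l -` U)"
    unfolding l_def by (intro open_vimage \<open>open U\<close> continuous_intros)
  moreover have "0 \<in> l -` U"
    using \<open>p \<in> U\<close> by (simp add: l_def)
  ultimately have "\<exists>d>0. \<forall>t. dist t 0 < d \<longrightarrow> t \<in> l -` U"
    unfolding open_dist by blast
  then obtain d where d: "d > 0" "\<And>t. \<bar>t\<bar> < d \<Longrightarrow> l t \<in> U"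
    by auto
  have D1: "((\<lambda>t. F (l t)) has_real_derivative F1 (l t) e) (at t)" if "\<bar>t\<bar> < d" for t
    using has_derivative_compose[OF l' F1[OF d(2)[OF that]]]
      linear_cmul[OF has_derivative_linear[OF F1[OF d(2)[OF that]]]]
    by (simp add: has_field_derivative_def mult_commute_abs)
  have "((\<lambda>x. F1 x e) has_derivative F2) (at (l 0))"
    using F2 by (simp add: l_def)
  from has_derivative_compose[OF l' this] linear_cmul[OF has_derivative_linear[OF F2]]
  have D2: "((\<lambda>t. F1 (l t) e) has_real_derivative F2 e) (at 0)"
    by (simp add: has_field_derivative_def mult_commute_abs)
  have "F1 p = (\<lambda>h. 0)"
    using differential_zero_maxmin[OF assms(2,1) F1[OF assms(2)]] max by blast
  then have zero: "F1 (l 0) e = 0"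
    by (simp add: l_def)
  obtain d' where d': "d' > 0" "\<And>h. 0 < h \<Longrightarrow> h < d' \<Longrightarrow> F1 (l h) e > 0"
    using has_real_derivative_pos_inc_right[OF D2] \<open>\<not> F2 e \<le> 0\<close> zero by fastforce
  define c where "c = min d d' / 2"
  have c: "0 < c" "c < d" "c < d'"
    using d d' by (auto simp: c_def)
  have "F (l 0) < F (l c)"
  proof (rule DERIV_pos_imp_increasing_open[OF \<open>0 < c\<close>])
    show "\<exists>y. DERIV (\<lambda>t. F (l t)) t :> y \<and> 0 < y" if "0 < t" "t < c" for t
      using D1[of t] d'(2)[of t] that c by auto
    show "continuous_on {0..c} (\<lambda>t. F (l t))"
      using c by (intro continuous_at_imp_continuous_on ballI DERIV_isCont[OF D1]) auto
  qed
  moreover have "F (l c) \<le> F (l 0)"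
    using max[of "l c"] d(2)[of c] c by (simp add: l_def)
  ultimately show False by simp
qed

text \<open>Writes the second derivative as the bilinear form of the iterated partials, so that the
  test at an interior maximum becomes a statement about a Hessian matrix.\<close>

lemma smooth_on_second_derivative:
  fixes w :: "real^'n::finite \<Rightarrow> real"
  assumes "open U" "smooth_on U w" "p \<in> U"
  shows "((\<lambda>x. frechet_derivative w (at x) e) has_derivative
    (\<lambda>h. \<Sum>i\<in>UNIV. \<Sum>j\<in>UNIV. h $ i * e $ j * pderiv_at i (pderiv_at j w) p)) (at p)"
proof -
  have A: "((\<lambda>x. \<Sum>j\<in>UNIV. e $ j * pderiv_at j w x) has_derivative
      (\<lambda>h. \<Sum>j\<in>UNIV. e $ j * frechet_derivative (pderiv_at j w) (at p) h)) (at p)"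
    by (intro has_derivative_sum has_derivative_mult_right smooth_on_has_derivative[OF _ \<open>p \<in> U\<close>]
        smooth_on_pderiv_at assms)
  have B: "(\<lambda>h. \<Sum>j\<in>UNIV. e $ j * frechet_derivative (pderiv_at j w) (at p) h)
      = (\<lambda>h. \<Sum>i\<in>UNIV. \<Sum>j\<in>UNIV. h $ i * e $ j * pderiv_at i (pderiv_at j w) p)"
    using has_derivative_pderiv_at(1)[OF smooth_on_has_derivative[OF smooth_on_pderiv_at[OF assms(2)] \<open>p \<in> U\<close>]]
    by (subst sum.swap) (simp add: sum_distrib_left mult_ac)
  have C: "(\<Sum>j\<in>UNIV. e $ j * pderiv_at j w x) = frechet_derivative w (at x) e" if "x \<in> U" for x
    using has_derivative_pderiv_at(1)[OF smooth_on_has_derivative[OF assms(2) that]] by simp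
  show ?thesis
    by (rule has_derivative_transform_within_open[OF A[unfolded B] assms(1,3) C])
qed

text \<open>The ball with diameter yz lies inside the ball about \<open>y\<close> through
  \<open>z\<close> and touches its sphere only at \<open>z\<close>. With d from \<open>y\<close> to
  the midpoint and v from the midpoint to \<open>x\<close>, the bound |v| <= |d| together with v
  \<noteq> d gives |d + v| < 2|d|.\<close>

lemma dist_less_of_midpoint:
  fixes x y z :: "'e::real_inner"
  assumes "dist x (midpoint y z) \<le> dist y z / 2" "x \<noteq> z"
  shows "dist x y < dist y z"
proof -
  define d where "d = midpoint y z - y"
  define v where "v = x - midpoint y z"
  have z: "z = y + 2 *\<^sub>R d" and x: "x = y + d + v"
    by (simp_all add: d_def v_def midpoint_def algebra_simps scaleR_2)
  have "midpoint y z = y + d" by (simp add: d_def)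
  with assms(1) z x have "norm v \<le> norm d"
    by (simp add: dist_norm)
  then have "v \<bullet> v \<le> d \<bullet> d"
    by (simp add: norm_le)
  moreover have "(v - d) \<bullet> (v - d) > 0"
    using assms(2) z x by (auto simp: scaleR_2)
  ultimately have "(d + v) \<bullet> (d + v) < (2 *\<^sub>R d) \<bullet> (2 *\<^sub>R d)"
    by (simp add: algebra_simps inner_commute)
  then show ?thesis
    unfolding norm_lt[symmetric] using z x by (simp add: dist_norm norm_minus_commute)
qed


text \<open>
  Hopf's argument: on a ball where \<open>w < m\<close> whose boundary touches \<open>{w = m}\<close> in a single point \<open>z\<close>,
  a small multiple of the barrier \<open>exp (-\<alpha> |x - y|\<^sup>2) - exp (-\<alpha> R\<^sup>2)\<close>, a strict subsolution near \<open>z\<close>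
  for large \<open>\<alpha>\<close>, is added to \<open>w\<close>. The sum has an interior maximum near \<open>z\<close>, which is impossible.
\<close>

lemma hopf_local:
  fixes w :: "real^'n::finite \<Rightarrow> real" and a :: "'n \<Rightarrow> 'n \<Rightarrow> real^'n \<Rightarrow> real"
  assumes "open U" and w: "smooth_on U w"
    and conta: "\<And>i j. continuous_on U (a i j)" and contb: "\<And>i. continuous_on U (b i)"
    and sym: "\<And>i j x. x \<in> U \<Longrightarrow> a i j x = a j i x"
    and pos: "\<And>x v. x \<in> U \<Longrightarrow> v \<noteq> 0 \<Longrightarrow> 0 < (\<Sum>i\<in>UNIV. \<Sum>j\<in>UNIV. a i j x * v $ i * v $ j)"
    and Lw: "\<And>x. x \<in> U \<Longrightarrow> 0 \<le> (\<Sum>i\<in>UNIV. \<Sum>j\<in>UNIV. a i j x * pderiv_at i (pderiv_at j w) x)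
                + (\<Sum>i\<in>UNIV. b i x * pderiv_at i w x)"
    and le: "\<And>x. x \<in> U \<Longrightarrow> w x \<le> m"
    and x0: "x0 \<in> U" "w x0 = m"
  shows "\<exists>r>0. ball x0 r \<subseteq> U \<and> (\<forall>x\<in>ball x0 r. w x = m)"
proof -
  \<comment> \<open>The factor 2 leaves room: a point of \<open>ball x0 r\<close> has its nearest
    point of \<open>{w = m}\<close> at distance less than \<open>r\<close>, since \<open>x0\<close>
    is a candidate, and hence within \<open>2 * r\<close> of \<open>x0\<close>.\<close>
  obtain r where r: "r > 0" "cball x0 (2 * r) \<subseteq> U"
  proof -
    obtain e where "e > 0" "cball x0 e \<subseteq> U"
      using \<open>open U\<close> x0 open_contains_cball by blast
    then show ?thesis using that[of "e / 2"] by simp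
  qed
  have contw: "continuous_on U w"
    by (rule smooth_on_continuous_on[OF w])
  have False if y1: "y1 \<in> ball x0 r" "w y1 \<noteq> m" for y1
  proof -
    define Z where "Z = {x \<in> cball x0 (2 * r). w x = m}"
    have "closed Z"
      using continuous_closed_preimage_constant[of "cball x0 (2 * r)" w m] continuous_on_subset[OF contw r(2)]
      by (simp add: Z_def)
    moreover have "x0 \<in> Z" using x0 r by (simp add: Z_def)
    ultimately obtain z where z: "z \<in> Z" "\<And>x. x \<in> Z \<Longrightarrow> dist y1 z \<le> dist y1 x"
      using distance_attains_inf[of Z y1] by blast
    have R1: "dist y1 z < r"
      using z(2)[OF \<open>x0 \<in> Z\<close>] y1 by (simp add: dist_commute)
    have "dist x0 z < 2 * r"
      using R1 y1 dist_triangle[of x0 z y1] by simp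
    have "z \<noteq> y1" using z(1) y1(2) by (auto simp: Z_def)
    \<comment> \<open>The ball about \<open>y1\<close> through \<open>z\<close> may touch
      \<open>{w = m}\<close> at several points. Halving it towards \<open>z\<close> leaves
      \<open>z\<close> as the only contact.\<close>
    define y where "y = midpoint y1 z"
    define R where "R = dist y1 z / 2"
    have R: "R > 0" "dist y z = R"
      using \<open>z \<noteq> y1\<close> by (simp_all add: R_def y_def dist_midpoint)
    have below: "w x < m" if "dist x y \<le> R" "x \<noteq> z" for x
    proof -
      have *: "dist y1 x < dist y1 z"
        using dist_less_of_midpoint[of x y1 z] that by (simp add: y_def R_def dist_commute)
      have "dist x0 x < 2 * r"
        using * R1 y1 dist_triangle[of x0 x y1] by simp
      then have "x \<in> cball x0 (2 * r)" by simp
      moreover have "x \<notin> Z" using z(2)[of x] * by force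
      ultimately show ?thesis using le[of x] r by (auto simp: Z_def)
    qed
    obtain e where e: "e > 0" "cball z e \<subseteq> U"
      using \<open>open U\<close> z(1) r(2) open_contains_cball unfolding Z_def by blast
    \<comment> \<open>The bound \<open>R / 2\<close> keeps the centre \<open>y\<close> away from
      \<open>cball z \<rho>\<close>, so \<open>x - y\<close> is nonzero and the quadratic form
      \<open>q\<close> is positive there.\<close>
    define \<rho> where "\<rho> = min e (R / 2)"
    have \<rho>: "\<rho> > 0" "\<rho> < R" "cball z \<rho> \<subseteq> U"
      using e R by (auto simp: \<rho>_def)
    have ne: "x - y \<noteq> 0" if "x \<in> cball z \<rho>" for x
      using that R \<rho> by (auto simp: dist_commute)
    \<comment> \<open>The operator applied to the function \<open>E\<close> defined below gives
      \<open>E x * (4 * \<alpha>\<^sup>2 * q x - 2 * \<alpha> * t x)\<close>: \<open>q\<close> comes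
      from the square of the gradient of the exponent, \<open>t\<close> from its second derivatives
      and the drift.\<close>
    define q where "q x = (\<Sum>i\<in>UNIV. \<Sum>j\<in>UNIV. a i j x * (x - y) $ i * (x - y) $ j)" for x
    define t where "t x = (\<Sum>i\<in>UNIV. a i i x) + (\<Sum>i\<in>UNIV. b i x * (x - y) $ i)" for x
    have cont: "continuous_on (cball z \<rho>) q" "continuous_on (cball z \<rho>) t"
      unfolding q_def t_def
      by (intro continuous_intros continuous_on_subset[OF conta] continuous_on_subset[OF contb] \<rho>(3))+
    have "cball z \<rho> \<noteq> {}" using \<rho> by simp
    obtain xq where xq: "xq \<in> cball z \<rho>" "\<And>x. x \<in> cball z \<rho> \<Longrightarrow> q xq \<le> q x"
      using continuous_attains_inf[OF compact_cball \<open>cball z \<rho> \<noteq> {}\<close> cont(1)] by blast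
    obtain xt where xt: "\<And>x. x \<in> cball z \<rho> \<Longrightarrow> t x \<le> t xt"
      using continuous_attains_sup[OF compact_cball \<open>cball z \<rho> \<noteq> {}\<close> cont(2)] by blast
    have "q xq > 0"
      unfolding q_def using pos[OF _ ne[OF xq(1)]] xq(1) \<rho>(3) by blast
    \<comment> \<open>Chosen so that \<open>2 * \<alpha> * q xq = \<bar>t xt\<bar> + 1\<close>: the
      least value of \<open>q\<close> then beats the largest value of \<open>t\<close> on the whole
      closed ball.\<close>
    define \<alpha> where "\<alpha> = (\<bar>t xt\<bar> + 1) / (2 * q xq)"
    have "\<alpha> > 0" using \<open>q xq > 0\<close> by (simp add: \<alpha>_def divide_pos_pos)
    have barrier: "4 * \<alpha>\<^sup>2 * q x - 2 * \<alpha> * t x > 0" if "x \<in> cball z \<rho>" for x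
    proof -
      have "t x < 2 * \<alpha> * q xq"
        using xt[OF that] \<open>q xq > 0\<close> by (simp add: \<alpha>_def)
      also have "\<dots> \<le> 2 * \<alpha> * q x"
        using xq(2)[OF that] \<open>\<alpha> > 0\<close> by simp
      finally have "0 < 2 * \<alpha> * (2 * \<alpha> * q x - t x)"
        using \<open>\<alpha> > 0\<close> by simp
      then show ?thesis by (simp add: algebra_simps power2_eq_square)
    qed
    define E where "E x = exp (- \<alpha> * ((x - y) \<bullet> (x - y)))" for x
    \<comment> \<open>The contact point \<open>z\<close> is not on the sphere, so
      \<open>w < m\<close> on this compact piece and the gap is uniform. As the barrier is at most
      1, the multiple \<open>\<delta> / 2\<close> of it cannot close the gap.\<close>
    have "\<exists>\<delta>>0. \<forall>x\<in>sphere z \<rho> \<inter> cball y R. w x \<le> m - \<delta>"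
    proof (cases "sphere z \<rho> \<inter> cball y R = {}")
      case True
      then show ?thesis using zero_less_one by blast
    next
      case False
      have "continuous_on (sphere z \<rho> \<inter> cball y R) w"
        using \<rho>(3) by (intro continuous_on_subset[OF contw]) auto
      then obtain p where p: "p \<in> sphere z \<rho> \<inter> cball y R" "\<And>x. x \<in> sphere z \<rho> \<inter> cball y R \<Longrightarrow> w x \<le> w p"
        using continuous_attains_sup[OF compact_Int[OF compact_sphere compact_cball] False] by blast
      have "w p < m"
        using p(1) \<rho>(1) by (intro below) (auto simp: dist_commute)
      then show ?thesis
        using p(2) by (intro exI[of _ "m - w p"]) auto
    qed
    then obtain \<delta> where \<delta>: "\<delta> > 0" "\<And>x. x \<in> sphere z \<rho> \<Longrightarrow> x \<in> cball y R \<Longrightarrow> w x \<le> m - \<delta>"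
      by blast
    define \<epsilon> where "\<epsilon> = \<delta> / 2"
    have \<epsilon>: "\<epsilon> > 0" "\<epsilon> < \<delta>" using \<delta> by (auto simp: \<epsilon>_def)
    define F where "F x = w x + \<epsilon> * (E x - exp (- \<alpha> * R\<^sup>2))" for x
    have "continuous_on (cball z \<rho>) F"
      unfolding F_def E_def by (intro continuous_intros continuous_on_subset[OF contw] \<rho>(3))
    then obtain p where p: "p \<in> cball z \<rho>" "\<And>x. x \<in> cball z \<rho> \<Longrightarrow> F x \<le> F p"
      using continuous_attains_sup[OF compact_cball \<open>cball z \<rho> \<noteq> {}\<close>] by blast
    have EE: "E x = exp (- \<alpha> * (dist x y)\<^sup>2)" for x
      by (simp add: E_def dist_norm dot_square_norm)
    have "F z = m"
      using z(1) R by (simp add: F_def EE Z_def dist_commute)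
    with p(2)[of z] \<rho>(1) have Fp: "F p \<ge> m" by simp
    \<comment> \<open>The barrier vanishes at \<open>z\<close>, so \<open>F z = m\<close>. On the
      sphere F stays below \<open>m\<close>: within \<open>cball y R\<close> because of the gap
      \<open>\<delta>\<close>, outside it because the barrier is negative there and \<open>w\<close>
      is at most \<open>m\<close>.\<close>
    have "p \<in> ball z \<rho>"
    proof (rule ccontr)
      assume "p \<notin> ball z \<rho>"
      then have sph: "p \<in> sphere z \<rho>" using p(1) by simp
      show False
      proof (cases "p \<in> cball y R")
        case True
        have "E p \<le> 1"
          using \<open>\<alpha> > 0\<close> by (simp add: EE)
        then have "E p - exp (- \<alpha> * R\<^sup>2) \<le> 1"
          using exp_gt_zero[of "- \<alpha> * R\<^sup>2"] by linarith
        then have "\<epsilon> * (E p - exp (- \<alpha> * R\<^sup>2)) \<le> \<epsilon> * 1"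
          using \<epsilon> by (intro mult_left_mono) auto
        then show False
          using \<delta>(2)[OF sph True] \<epsilon>(2) Fp unfolding F_def by linarith
      next
        case False
        then have "R\<^sup>2 < (dist p y)\<^sup>2"
          using R by (intro power_strict_mono) (auto simp: dist_commute)
        then have "E p - exp (- \<alpha> * R\<^sup>2) < 0"
          using \<open>\<alpha> > 0\<close> by (simp add: EE)
        then have "\<epsilon> * (E p - exp (- \<alpha> * R\<^sup>2)) < 0"
          using \<epsilon> by (simp add: mult_pos_neg)
        then show False
          using le[of p] p(1) \<rho>(3) Fp by (auto simp: F_def)
      qed
    qed
    have pU: "p \<in> U" using p(1) \<rho>(3) by blast
    define F1 where "F1 x v = frechet_derivative w (at x) v - \<epsilon> * (2 * \<alpha> * ((x - y) \<bullet> v) * E x)" for x v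
    have E': "(E has_derivative (\<lambda>v. - (2 * \<alpha> * ((x - y) \<bullet> v) * E x))) (at x)" for x
      unfolding E_def by (auto intro!: derivative_eq_intros simp: algebra_simps inner_commute)
    have F': "(F has_derivative F1 x) (at x)" if "x \<in> U" for x
      unfolding F_def F1_def
      by (rule derivative_eq_intros smooth_on_has_derivative[OF w that] E' refl)+ (auto simp: algebra_simps)
    \<comment> \<open>The Hessian of \<open>F\<close> at \<open>p\<close>, with the second
      derivatives of the barrier written out.\<close>
    define H where "H i j = pderiv_at i (pderiv_at j w) p
      + \<epsilon> * E p * (4 * \<alpha>\<^sup>2 * (p - y) $ i * (p - y) $ j - (if i = j then 2 * \<alpha> else 0))" for i j
    have "F1 p = (\<lambda>v. 0)"
      using differential_zero_maxmin[OF _ open_ball F'[OF pU]] \<open>p \<in> ball z \<rho>\<close> p(2)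
      by (metis ball_subset_cball subsetD)
    then have "F1 p (axis i 1) = 0" for i by simp
    then have first: "pderiv_at i w p = 2 * \<alpha> * \<epsilon> * E p * (p - y) $ i" for i
      by (simp add: F1_def pderiv_at_def inner_axis algebra_simps)
    have H: "(\<Sum>i\<in>UNIV. \<Sum>j\<in>UNIV. H i j * v i * v j) \<le> 0" for v
    proof -
      define e :: "real^'n" where "e = (\<chi> i. v i)"
      define F2 where "F2 h = (\<Sum>i\<in>UNIV. \<Sum>j\<in>UNIV. h $ i * e $ j * pderiv_at i (pderiv_at j w) p)
        - \<epsilon> * (2 * \<alpha> * (h \<bullet> e) * E p - 2 * \<alpha> * ((p - y) \<bullet> e) * (2 * \<alpha> * ((p - y) \<bullet> h) * E p))" for h
      have "((\<lambda>x. F1 x e) has_derivative F2) (at p)"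
        unfolding F1_def F2_def
        by (rule derivative_eq_intros smooth_on_second_derivative[OF \<open>open U\<close> w pU] E' refl)+
          (auto simp: algebra_simps)
      then have "F2 e \<le> 0"
        using F' subsetD[OF \<rho>(3)] p(2) \<open>p \<in> ball z \<rho>\<close>
        by (intro interior_max_second_derivative[of "ball z \<rho>" p F F1 e F2]) auto
      moreover have "F2 e = (\<Sum>i\<in>UNIV. \<Sum>j\<in>UNIV. H i j * v i * v j)"
      proof -
        have "(p - y) \<bullet> e * ((p - y) \<bullet> e) = (\<Sum>i\<in>UNIV. \<Sum>j\<in>UNIV. (p - y) $ i * v i * ((p - y) $ j * v j))"
          by (simp add: inner_vec_def e_def sum_product)
        moreover have "e \<bullet> e = (\<Sum>i\<in>UNIV. \<Sum>j\<in>UNIV. (if i = j then v i * v j else 0))"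
          by (simp add: inner_vec_def e_def)
        moreover have "F2 e = (\<Sum>i\<in>UNIV. \<Sum>j\<in>UNIV. v i * v j * pderiv_at i (pderiv_at j w) p)
            + (4 * \<alpha>\<^sup>2 * \<epsilon> * E p) * ((p - y) \<bullet> e * ((p - y) \<bullet> e)) - (2 * \<alpha> * \<epsilon> * E p) * (e \<bullet> e)"
          by (simp add: F2_def e_def algebra_simps power2_eq_square)
        ultimately have "F2 e = (\<Sum>i\<in>UNIV. \<Sum>j\<in>UNIV. v i * v j * pderiv_at i (pderiv_at j w) p
            + (4 * \<alpha>\<^sup>2 * \<epsilon> * E p) * ((p - y) $ i * v i * ((p - y) $ j * v j))
            - (2 * \<alpha> * \<epsilon> * E p) * (if i = j then v i * v j else 0))"
          by (simp only: sum.distrib sum_subtractf sum_distrib_left)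
        also have "\<dots> = (\<Sum>i\<in>UNIV. \<Sum>j\<in>UNIV. H i j * v i * v j)"
          by (intro sum.cong refl) (simp add: H_def algebra_simps)
        finally show ?thesis .
      qed
      ultimately show ?thesis by simp
    qed
    have "(\<Sum>i\<in>UNIV. \<Sum>j\<in>UNIV. a i j p * H i j) \<le> 0"
    proof (rule semidefinite_sum_mult_nonpos)
      show "0 \<le> (\<Sum>i\<in>UNIV. \<Sum>j\<in>UNIV. a i j p * v i * v j)" for v
        using pos[OF pU, of "\<chi> i. v i"] by (cases "(\<chi> i. v i) = (0 :: real^'n)") (auto simp: vec_eq_iff)
    qed (use sym[OF pU] H in auto)
    \<comment> \<open>The gradient of \<open>F\<close> vanishes at \<open>p\<close>, so
      \<open>first\<close> turns the drift of \<open>w\<close> into that of the barrier. The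
      operator on \<open>w\<close> is then the nonpositive trace of \<open>a\<close> times
      \<open>H\<close> minus a positive term, against \<open>Lw\<close>.\<close>
    moreover have "(\<Sum>i\<in>UNIV. \<Sum>j\<in>UNIV. a i j p * pderiv_at i (pderiv_at j w) p) + (\<Sum>i\<in>UNIV. b i p * pderiv_at i w p)
       = (\<Sum>i\<in>UNIV. \<Sum>j\<in>UNIV. a i j p * H i j) - \<epsilon> * E p * (4 * \<alpha>\<^sup>2 * q p - 2 * \<alpha> * t p)"
    proof -
      have "(\<Sum>i\<in>UNIV. \<Sum>j\<in>UNIV. a i j p * H i j) =
          (\<Sum>i\<in>UNIV. \<Sum>j\<in>UNIV. a i j p * pderiv_at i (pderiv_at j w) p
            + (\<epsilon> * E p * (4 * \<alpha>\<^sup>2)) * (a i j p * (p - y) $ i * (p - y) $ j)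
            - (if i = j then (\<epsilon> * E p * (2 * \<alpha>)) * a i j p else 0))"
        by (intro sum.cong refl) (simp add: H_def algebra_simps)
      also have "\<dots> = (\<Sum>i\<in>UNIV. \<Sum>j\<in>UNIV. a i j p * pderiv_at i (pderiv_at j w) p)
          + (\<epsilon> * E p * (4 * \<alpha>\<^sup>2)) * q p - (\<epsilon> * E p * (2 * \<alpha>)) * (\<Sum>i\<in>UNIV. a i i p)"
        by (simp add: sum.distrib sum_subtractf sum_distrib_left q_def)
      finally have "(\<Sum>i\<in>UNIV. \<Sum>j\<in>UNIV. a i j p * H i j) = \<dots>" .
      moreover have "(\<Sum>i\<in>UNIV. b i p * pderiv_at i w p) = (\<epsilon> * E p * (2 * \<alpha>)) * (\<Sum>i\<in>UNIV. b i p * (p - y) $ i)"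
        unfolding first sum_distrib_left by (intro sum.cong refl) (simp add: algebra_simps)
      ultimately show ?thesis
        by (simp add: t_def algebra_simps)
    qed
    moreover have "\<epsilon> * E p * (4 * \<alpha>\<^sup>2 * q p - 2 * \<alpha> * t p) > 0"
      using barrier[OF p(1)] \<epsilon> by (simp add: E_def)
    ultimately show False
      using Lw[OF pU] by simp
  qed
  moreover have "ball x0 r \<subseteq> U"
    using r ball_subset_cball[of x0 r] by (auto simp: subset_iff)
  ultimately show ?thesis
    using r(1) by blast
qed


section \<open>Symmetry of second derivatives\<close>

text \<open>Two uses of the mean value theorem: in direction \<open>v\<close> for the difference
  \<open>g\<close> of F along two parallel segments, then in direction \<open>w\<close> for the
  derivative of F along \<open>v\<close>.\<close>

lemma second_difference_mean_value:
  fixes F :: "'e::real_normed_vector \<Rightarrow> real"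
  assumes "smooth_on U F" "t > 0"
    and U: "\<And>a b. 0 \<le> a \<Longrightarrow> a \<le> t \<Longrightarrow> 0 \<le> b \<Longrightarrow> b \<le> t \<Longrightarrow> p + a *\<^sub>R v + b *\<^sub>R w \<in> U"
  obtains a b where "0 \<le> a" "a \<le> t" "0 \<le> b" "b \<le> t"
    "F (p + t *\<^sub>R v + t *\<^sub>R w) - F (p + t *\<^sub>R v) - F (p + t *\<^sub>R w) + F p
      = t\<^sup>2 * frechet_derivative (\<lambda>x. frechet_derivative F (at x) v) (at (p + a *\<^sub>R v + b *\<^sub>R w)) w"
proof -
  have line: "((\<lambda>s. H (q + s *\<^sub>R e)) has_real_derivative frechet_derivative H (at (q + s *\<^sub>R e)) e) (at s)"
    if "smooth_on U H" "q + s *\<^sub>R e \<in> U" for H :: "'e \<Rightarrow> real" and q e s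
  proof -
    have l: "((\<lambda>s. q + s *\<^sub>R e) has_derivative (\<lambda>h. h *\<^sub>R e)) (at s)"
      by (auto intro!: derivative_eq_intros)
    show ?thesis
      using has_derivative_compose[OF l smooth_on_has_derivative[OF that]]
        linear_cmul[OF has_derivative_linear[OF smooth_on_has_derivative[OF that]]]
      by (simp add: has_field_derivative_def mult_commute_abs)
  qed
  define D where "D x = frechet_derivative F (at x) v" for x
  have smD: "smooth_on U D"
    unfolding D_def by (rule smooth_on_frechet_derivative[OF assms(1)])
  define g where "g s = F ((p + t *\<^sub>R w) + s *\<^sub>R v) - F (p + s *\<^sub>R v)" for s
  have "(g has_real_derivative (D ((p + t *\<^sub>R w) + s *\<^sub>R v) - D (p + s *\<^sub>R v))) (at s)"
    if "0 \<le> s" "s \<le> t" for s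
    unfolding g_def D_def using that U[of s t] U[of s 0] \<open>t > 0\<close>
    by (intro DERIV_diff line[OF assms(1)]) (auto simp: algebra_simps)
  from MVT2[OF \<open>t > 0\<close> this]
  obtain a where a: "0 < a" "a < t" "g t - g 0 = t * (D ((p + t *\<^sub>R w) + a *\<^sub>R v) - D (p + a *\<^sub>R v))"
    by auto
  have "((\<lambda>s. D ((p + a *\<^sub>R v) + s *\<^sub>R w)) has_real_derivative
      frechet_derivative D (at ((p + a *\<^sub>R v) + s *\<^sub>R w)) w) (at s)" if "0 \<le> s" "s \<le> t" for s
    using that U[of a s] a by (intro line[OF smD]) auto
  from MVT2[OF \<open>t > 0\<close> this]
  obtain b where b: "0 < b" "b < t"
      "D (p + a *\<^sub>R v + t *\<^sub>R w) - D (p + a *\<^sub>R v) = t * frechet_derivative D (at (p + a *\<^sub>R v + b *\<^sub>R w)) w"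
    by auto
  have "g t - g 0 = t * (t * frechet_derivative D (at (p + a *\<^sub>R v + b *\<^sub>R w)) w)"
    using a(3) b(3) by (simp add: add_ac)
  then have "F (p + t *\<^sub>R v + t *\<^sub>R w) - F (p + t *\<^sub>R v) - F (p + t *\<^sub>R w) + F p
      = t\<^sup>2 * frechet_derivative D (at (p + a *\<^sub>R v + b *\<^sub>R w)) w"
    by (simp add: g_def power2_eq_square add_ac)
  with a b show ?thesis
    unfolding D_def[abs_def] by (intro that[of a b]) auto
qed

text \<open>The second difference over a parallelogram is symmetric in \<open>v\<close> and
  \<open>w\<close>. Hence the two mixed derivatives agree at some points arbitrarily near
  \<open>p\<close>, and by continuity at \<open>p\<close>.\<close>

lemma symmetric_second_derivative_real:
  fixes F :: "'e::real_normed_vector \<Rightarrow> real"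
  assumes "open U" "smooth_on U F" "p \<in> U"
  shows "frechet_derivative (\<lambda>x. frechet_derivative F (at x) v) (at p) w
       = frechet_derivative (\<lambda>x. frechet_derivative F (at x) w) (at p) v"
proof (rule ccontr)
  define A where "A q = frechet_derivative (\<lambda>x. frechet_derivative F (at x) v) (at q) w" for q
  define B where "B q = frechet_derivative (\<lambda>x. frechet_derivative F (at x) w) (at q) v" for q
  assume "\<not> ?thesis"
  then have ne: "A p \<noteq> B p" by (simp add: A_def B_def)
  \<comment> \<open>Half the supposed gap: one number cannot be strictly closer than this to both
    \<open>A p\<close> and \<open>B p\<close>.\<close>
  define \<epsilon> where "\<epsilon> = \<bar>A p - B p\<bar> / 2"
  have "\<epsilon> > 0" using ne by (simp add: \<epsilon>_def)
  have "isCont A p" "isCont B p"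
    unfolding A_def B_def
    using continuous_on_eq_continuous_at[OF assms(1)] assms(3)
      smooth_on_continuous_on[OF smooth_on_frechet_derivative[OF smooth_on_frechet_derivative[OF assms(2)]]]
    by blast+
  then obtain d1 d2 where d1: "d1 > 0" "\<And>q. dist q p < d1 \<Longrightarrow> dist (A q) (A p) < \<epsilon>"
    and d2: "d2 > 0" "\<And>q. dist q p < d2 \<Longrightarrow> dist (B q) (B p) < \<epsilon>"
    unfolding continuous_at_eps_delta using \<open>\<epsilon> > 0\<close> by metis
  obtain d3 where d3: "d3 > 0" "ball p d3 \<subseteq> U"
    using assms(1,3) open_contains_ball by blast
  define d where "d = min d1 (min d2 d3)"
  have d: "d > 0" "d \<le> d1" "d \<le> d2" "d \<le> d3"
    using d1 d2 d3 by (auto simp: d_def)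
  \<comment> \<open>Keeps the whole parallelogram with sides \<open>t *\<^sub>R v\<close> and
    \<open>t *\<^sub>R w\<close> within distance \<open>d\<close> of \<open>p\<close>; the summand 1
    makes the denominator positive and the bound strict.\<close>
  define t where "t = d / (norm v + norm w + 1)"
  have "norm v + norm w + 1 > 0" by (simp add: add_nonneg_pos)
  have "t > 0" using d \<open>norm v + norm w + 1 > 0\<close> by (simp add: t_def)
  have near: "dist (p + a *\<^sub>R v + b *\<^sub>R w) p < d" if "0 \<le> a" "a \<le> t" "0 \<le> b" "b \<le> t" for a b
  proof -
    have "dist (p + a *\<^sub>R v + b *\<^sub>R w) p = norm (a *\<^sub>R v + b *\<^sub>R w)"
      by (simp add: dist_norm add.assoc)
    also have "\<dots> \<le> a * norm v + b * norm w"
      using norm_triangle_ineq[of "a *\<^sub>R v" "b *\<^sub>R w"] that by simp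
    also have "\<dots> \<le> t * norm v + t * norm w"
      using that by (intro add_mono mult_right_mono) auto
    also have "\<dots> < t * (norm v + norm w + 1)"
      using \<open>t > 0\<close> by (simp add: algebra_simps)
    also have "\<dots> = d"
      using \<open>norm v + norm w + 1 > 0\<close> by (simp add: t_def)
    finally show ?thesis .
  qed
  have inU: "p + a *\<^sub>R v + b *\<^sub>R w \<in> U" if "0 \<le> a" "a \<le> t" "0 \<le> b" "b \<le> t" for a b
    using near[OF that] d d3 by (auto simp: dist_commute subset_iff)
  obtain a b where ab: "0 \<le> a" "a \<le> t" "0 \<le> b" "b \<le> t"
    "F (p + t *\<^sub>R v + t *\<^sub>R w) - F (p + t *\<^sub>R v) - F (p + t *\<^sub>R w) + F p = t\<^sup>2 * A (p + a *\<^sub>R v + b *\<^sub>R w)"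
    using second_difference_mean_value[OF assms(2) \<open>t > 0\<close>, of p v w] inU unfolding A_def by blast
  have inU': "p + a *\<^sub>R w + b *\<^sub>R v \<in> U" if "0 \<le> a" "a \<le> t" "0 \<le> b" "b \<le> t" for a b
    using inU[of b a] that by (simp add: add_ac)
  obtain a' b' where ab': "0 \<le> a'" "a' \<le> t" "0 \<le> b'" "b' \<le> t"
    "F (p + t *\<^sub>R w + t *\<^sub>R v) - F (p + t *\<^sub>R w) - F (p + t *\<^sub>R v) + F p = t\<^sup>2 * B (p + a' *\<^sub>R w + b' *\<^sub>R v)"
    using second_difference_mean_value[OF assms(2) \<open>t > 0\<close>, of p w v] inU' unfolding B_def by blast
  have swap: "p + r *\<^sub>R w + s *\<^sub>R v = p + s *\<^sub>R v + r *\<^sub>R w" for r s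
    by (simp add: add_ac)
  have "t\<^sup>2 * A (p + a *\<^sub>R v + b *\<^sub>R w) = t\<^sup>2 * B (p + b' *\<^sub>R v + a' *\<^sub>R w)"
    using ab(5) ab'(5) unfolding swap by linarith
  then have "A (p + a *\<^sub>R v + b *\<^sub>R w) = B (p + b' *\<^sub>R v + a' *\<^sub>R w)"
    using \<open>t > 0\<close> by simp
  moreover have "dist (A (p + a *\<^sub>R v + b *\<^sub>R w)) (A p) < \<epsilon>"
    using near[OF ab(1-4)] d by (intro d1) auto
  moreover have "dist (B (p + b' *\<^sub>R v + a' *\<^sub>R w)) (B p) < \<epsilon>"
    using near[OF ab'(3,4,1,2)] d by (intro d2) auto
  ultimately show False
    by (auto simp: \<epsilon>_def dist_real_def abs_if field_simps split: if_splits)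
qed

text \<open>Components may lie in any Euclidean space, so a second application reduces matrix-valued
  maps to their real entries.\<close>

lemma has_derivative_vec_nth_iff:
  fixes f :: "'e::real_normed_vector \<Rightarrow> 'b::euclidean_space^'n::finite"
  shows "(f has_derivative f') (at x) \<longleftrightarrow> (\<forall>i. ((\<lambda>x. f x $ i) has_derivative (\<lambda>h. f' h $ i)) (at x))"
proof
  assume "(f has_derivative f') (at x)"
  then show "\<forall>i. ((\<lambda>x. f x $ i) has_derivative (\<lambda>h. f' h $ i)) (at x)"
    by (auto intro: bounded_linear.has_derivative[OF bounded_linear_vec_nth])
next
  assume *: "\<forall>i. ((\<lambda>x. f x $ i) has_derivative (\<lambda>h. f' h $ i)) (at x)"
  show "(f has_derivative f') (at x)"
  proof (subst has_derivative_componentwise_within, rule ballI)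
    fix b :: "'b^'n"
    assume "b \<in> Basis"
    then obtain i b' where b: "b = axis i b'"
      by (auto simp: Basis_vec_def)
    have "((\<lambda>x. f x $ i \<bullet> b') has_derivative (\<lambda>h. f' h $ i \<bullet> b')) (at x)"
      by (intro has_derivative_inner_left * [rule_format])
    then show "((\<lambda>x. f x \<bullet> b) has_derivative (\<lambda>h. f' h \<bullet> b)) (at x)"
      by (simp add: b inner_axis)
  qed
qed

lemma smooth_on_vec_nth:
  fixes F :: "'e::real_normed_vector \<Rightarrow> real^'n::finite"
  assumes "open U" "smooth_on U F"
  shows "smooth_on U (\<lambda>x. F x $ i)"
  by (rule smooth_on_bounded_linear[OF bounded_linear_vec_nth assms])

lemma frechet_derivative_vec_nth:
  fixes F :: "'e::real_normed_vector \<Rightarrow> real^'n::finite"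
  assumes "(F has_derivative F') (at x)"
  shows "frechet_derivative (\<lambda>x. F x $ i) (at x) v = F' v $ i"
proof -
  have "((\<lambda>x. F x $ i) has_derivative (\<lambda>h. F' h $ i)) (at x)"
    using assms has_derivative_vec_nth_iff by blast
  then show ?thesis
    using frechet_derivative_at by metis
qed

lemma symmetric_second_derivative:
  fixes F :: "'e::real_normed_vector \<Rightarrow> real^'n::finite"
  assumes "open U" "smooth_on U F" "p \<in> U"
  shows "frechet_derivative (\<lambda>x. frechet_derivative F (at x) v) (at p) w
       = frechet_derivative (\<lambda>x. frechet_derivative F (at x) w) (at p) v"
proof -
  have *: "frechet_derivative (\<lambda>x. frechet_derivative F (at x) v) (at p) w $ i
      = frechet_derivative (\<lambda>x. frechet_derivative (\<lambda>x. F x $ i) (at x) v) (at p) w" for v w i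
  proof -
    have sm: "smooth_on U (\<lambda>x. frechet_derivative F (at x) v)"
      by (rule smooth_on_frechet_derivative[OF assms(2)])
    have "frechet_derivative (\<lambda>x. frechet_derivative F (at x) v) (at p) w $ i
        = frechet_derivative (\<lambda>x. frechet_derivative F (at x) v $ i) (at p) w"
      using frechet_derivative_vec_nth[OF smooth_on_has_derivative[OF sm assms(3)]] by simp
    also have "\<dots> = frechet_derivative (\<lambda>x. frechet_derivative (\<lambda>x. F x $ i) (at x) v) (at p) w"
    proof (rule fun_cong[OF frechet_derivative_transform_within_open[OF _ assms(1,3)]])
      show "(\<lambda>x. frechet_derivative F (at x) v $ i) differentiable at p"
        using smooth_on_has_derivative[OF smooth_on_vec_nth[OF assms(1) sm] assms(3)]
        by (auto simp: differentiable_def)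
      show "frechet_derivative F (at x) v $ i = frechet_derivative (\<lambda>x. F x $ i) (at x) v" if "x \<in> U" for x
        using frechet_derivative_vec_nth[OF smooth_on_has_derivative[OF assms(2) that]] by simp
    qed
    finally show ?thesis .
  qed
  show ?thesis
    unfolding vec_eq_iff *
    using symmetric_second_derivative_real[OF assms(1) smooth_on_vec_nth[OF assms(1,2)] assms(3)] by blast
qed


section \<open>Invariance of the coordinate divergence\<close>

lemma bounded_bilinear_matrix_mult:
  "bounded_bilinear ((**) :: real^'n::finite^'m::finite \<Rightarrow> real^'k::finite^'n \<Rightarrow> real^'k^'m)"
  unfolding bilinear_conv_bounded_bilinear[symmetric] bilinear_def
  by (auto intro!: linearI simp: matrix_matrix_mult_def vec_eq_iff sum.distrib sum_distrib_left algebra_simps)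

lemma bounded_bilinear_matrix_vector_mult:
  "bounded_bilinear ((*v) :: real^'n::finite^'m::finite \<Rightarrow> real^'n \<Rightarrow> real^'m)"
  unfolding bilinear_conv_bounded_bilinear[symmetric] bilinear_def
  by (auto intro!: linearI simp: matrix_vector_mult_def vec_eq_iff sum.distrib sum_distrib_left algebra_simps)

lemma bounded_linear_transpose:
  "bounded_linear (transpose :: real^'n::finite^'m::finite \<Rightarrow> real^'m^'n)"
  unfolding linear_conv_bounded_linear[symmetric]
  by (auto intro!: linearI simp: transpose_def vec_eq_iff)

lemma matrix_add_rdistrib: "(A + B) ** C = A ** C + (B ** C :: 'a::semiring_1^'n::finite^'m::finite)"
  by (simp add: matrix_matrix_mult_def vec_eq_iff sum.distrib distrib_right)

lemma trace_transpose: "trace (transpose A) = trace A"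
  by (simp add: trace_def transpose_def)

lemma trace_conjugate:
  assumes "B ** A = mat 1"
  shows "trace (A ** C ** B) = trace (C :: 'a::comm_semiring_1^'n::finite^'n)"
  by (metis assms matrix_mul_assoc matrix_mul_lid trace_mul_sym)

text \<open>
  Here \<open>J\<close> is the Jacobian of a coordinate change \<open>\<phi>\<close>, \<open>X\<close> and \<open>Y\<close> are the components of a vector field
  and \<open>G\<close> and \<open>K\<close> those of the metric. The derivative of \<open>J\<close> in direction \<open>X\<close> contributes
  \<open>tr (J' X J\<^sup>-\<^sup>1)\<close> to the trace of \<open>Y'\<close>, which compensates the
  difference of the two metric terms.
\<close>

lemma coordinate_divergence_invariant:
  fixes X Y \<phi> :: "real^'n::finite \<Rightarrow> real^'n" and G K J :: "real^'n \<Rightarrow> real^'n^'n"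
  assumes \<phi>: "(\<phi> has_derivative (*v) (J x)) (at x)"
    and J: "(J has_derivative J') (at x)"
    and sym: "\<And>v w. J' v *v w = J' w *v v"
    and X: "(X has_derivative X') (at x)" and Y: "(Y has_derivative Y') (at (\<phi> x))"
    and G: "(G has_derivative G') (at x)" and K: "(K has_derivative K') (at (\<phi> x))"
    and inv: "invertible (J x)" "invertible (K (\<phi> x))"
    and S: "open S" "x \<in> S"
    and XY: "\<And>y. y \<in> S \<Longrightarrow> Y (\<phi> y) = J y *v X y"
    and GK: "\<And>y. y \<in> S \<Longrightarrow> G y = transpose (J y) ** K (\<phi> y) ** J y"
  shows "trace (matrix X') + trace (matrix_inv (G x) ** G' (X x)) / 2
       = trace (matrix Y') + trace (matrix_inv (K (\<phi> x)) ** K' (Y (\<phi> x))) / 2"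
proof -
  define A where "A = J x"
  define B where "B = matrix_inv A"
  define Q where "Q = K (\<phi> x)"
  define P where "P = matrix_inv Q"
  define D where "D = J' (X x)"
  have AB: "A ** B = mat 1" "B ** A = mat 1"
    unfolding B_def A_def using matrix_inv_mult[OF inv(1)] by auto
  have QP: "Q ** P = mat 1" "P ** Q = mat 1"
    unfolding P_def Q_def using matrix_inv_mult[OF inv(2)] by auto
  have ABt: "transpose B ** transpose A = mat 1" "transpose A ** transpose B = mat 1"
    unfolding matrix_transpose_mul[symmetric] AB by (simp_all add: transpose_mat)
  have Yx: "Y (\<phi> x) = A *v X x"
    using XY[OF S(2)] by (simp add: A_def)
  have "((\<lambda>y. Y (\<phi> y)) has_derivative (\<lambda>v. Y' (J x *v v))) (at x)"
    by (rule has_derivative_compose[OF \<phi> Y])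
  moreover have "((\<lambda>y. Y (\<phi> y)) has_derivative (\<lambda>v. J x *v X' v + J' v *v X x)) (at x)"
    by (rule has_derivative_transform_within_open[OF
          bounded_bilinear.FDERIV[OF bounded_bilinear_matrix_vector_mult J X] S]) (simp add: XY)
  \<comment> \<open>The product rule leaves \<open>J' v *v X x\<close>; the symmetry of
    \<open>J'\<close> makes it a fixed matrix \<open>D\<close> applied to \<open>v\<close>, so that
    a trace can be taken.\<close>
  ultimately have Y': "Y' (A *v v) = A *v X' v + D *v v" for v
    using has_derivative_unique by (metis (mono_tags, lifting) A_def D_def sym)
  have mX: "matrix X' *v v = X' v" and mY: "matrix Y' *v v = Y' v" for v
    using X Y has_derivative_linear by (auto simp: matrix_works linear_matrix_vector_mul_eq)
  have "matrix Y' ** A = A ** matrix X' + D"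
    unfolding matrix_eq matrix_vector_mul_assoc[symmetric] matrix_vector_mult_add_rdistrib mX mY
    by (simp add: Y')
  then have "matrix Y' ** A ** B = A ** matrix X' ** B + D ** B"
    by (simp add: matrix_add_rdistrib)
  then have "matrix Y' = A ** matrix X' ** B + D ** B"
    by (simp add: matrix_mul_assoc[symmetric] AB)
  then have trY: "trace (matrix Y') = trace (matrix X') + trace (D ** B)"
    by (simp add: trace_add trace_conjugate[OF AB(2)])
  have "((\<lambda>y. transpose (J y) ** K (\<phi> y) ** J y) has_derivative
      (\<lambda>v. (transpose (J x) ** K (\<phi> x)) ** J' v
        + (transpose (J x) ** K' (J x *v v) + transpose (J' v) ** K (\<phi> x)) ** J x)) (at x)"
    by (rule bounded_bilinear.FDERIV[OF bounded_bilinear_matrix_mult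
        bounded_bilinear.FDERIV[OF bounded_bilinear_matrix_mult
          bounded_linear.has_derivative[OF bounded_linear_transpose J] has_derivative_compose[OF \<phi> K]] J])
  then have "(G has_derivative
      (\<lambda>v. (transpose (J x) ** K (\<phi> x)) ** J' v
        + (transpose (J x) ** K' (J x *v v) + transpose (J' v) ** K (\<phi> x)) ** J x)) (at x)"
    by (rule has_derivative_transform_within_open[OF _ S]) (simp add: GK)
  then have G': "G' (X x) = transpose A ** Q ** D + (transpose A ** K' (Y (\<phi> x)) + transpose D ** Q) ** A"
    using fun_cong[OF has_derivative_unique[OF G], of _ "X x"] by (simp add: A_def Q_def D_def Yx)
  have Gx: "G x = transpose A ** Q ** A"
    using GK[OF S(2)] by (simp add: A_def Q_def)
  \<comment> \<open>The inverse metric transforms with the inverse Jacobian on both sides; the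
    identities numbered 1 to 3 use this form to cancel the factors \<open>A\<close>.\<close>
  define C where "C = B ** P ** transpose B"
  have "invertible (G x)"
  proof -
    have "invertible (transpose A)"
      unfolding invertible_def using ABt by blast
    then show ?thesis
      unfolding Gx using inv by (intro invertible_mult) (auto simp: A_def Q_def)
  qed
  have "C ** G x = mat 1"
    unfolding C_def Gx by (metis AB(2) ABt(1) QP(2) matrix_mul_assoc matrix_mul_lid)
  then have C: "matrix_inv (G x) = C"
    by (metis \<open>invertible (G x)\<close> matrix_inv_mult(1) matrix_mul_assoc matrix_mul_lid matrix_mul_rid)
  have 1: "C ** (transpose A ** Q ** D) = B ** D"
    unfolding C_def by (metis ABt(1) QP(2) matrix_mul_assoc matrix_mul_rid)
  have 2: "C ** (transpose A ** K' (Y (\<phi> x)) ** A) = B ** (P ** K' (Y (\<phi> x))) ** A"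
    unfolding C_def by (metis ABt(1) matrix_mul_assoc matrix_mul_rid)
  have 3: "C ** (transpose D ** Q ** A) = B ** (P ** (transpose B ** transpose D) ** Q) ** A"
    unfolding C_def by (simp add: matrix_mul_assoc)
  \<comment> \<open>The two terms of \<open>G'\<close> that contain \<open>D\<close> each contribute
    \<open>trace (D ** B)\<close>. After halving they add up to exactly the amount in
    \<open>trY\<close>.\<close>
  have "trace (matrix_inv (G x) ** G' (X x))
      = trace (B ** D) + (trace (B ** (P ** K' (Y (\<phi> x))) ** A) + trace (B ** (P ** (transpose B ** transpose D) ** Q) ** A))"
    unfolding C G' matrix_add_rdistrib matrix_add_ldistrib trace_add 1 2 3 ..
  also have "\<dots> = trace (B ** D) + (trace (P ** K' (Y (\<phi> x))) + trace (transpose B ** transpose D))"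
    by (simp add: trace_conjugate[OF AB(1)] trace_conjugate[OF QP(1)])
  also have "trace (transpose B ** transpose D) = trace (D ** B)"
    unfolding matrix_transpose_mul[symmetric] by (rule trace_transpose)
  also have "trace (B ** D) = trace (D ** B)"
    by (rule trace_mul_sym)
  finally show ?thesis
    unfolding trY P_def Q_def by simp
qed


section \<open>Charts and tangent vectors\<close>

lemma frechet_derivative_compose_open:
  assumes "open S" "x \<in> S" "\<And>y. y \<in> S \<Longrightarrow> h y = f (g y)"
    and "(g has_derivative g') (at x)" "(f has_derivative f') (at (g x))"
  shows "(h has_derivative (\<lambda>v. f' (g' v))) (at x)" "frechet_derivative h (at x) = (\<lambda>v. f' (g' v))"
proof -
  show "(h has_derivative (\<lambda>v. f' (g' v))) (at x)"
    by (rule has_derivative_transform_within_open[OF has_derivative_compose[OF assms(4,5)] assms(1,2)])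
       (simp add: assms(3))
  then show "frechet_derivative h (at x) = (\<lambda>v. f' (g' v))"
    using frechet_derivative_at by metis
qed

text \<open>For \<open>c\<close> around \<open>p\<close> this is the inverse of reading off
  components in \<open>c\<close>, hence the identification of \<open>real^'n\<close> with the
  tangent space.\<close>

definition coord_tangent ::
  "('a, 'n::finite) chart set \<Rightarrow> ('a, 'n) chart \<Rightarrow> 'a \<Rightarrow> real^'n \<Rightarrow> ('a, 'n) tangent" where
  "coord_tangent A c p a =
     (\<lambda>d. if d \<in> charts_at A p then frechet_derivative (transition c d) (at (chart_map c p)) a else 0)"

lemma coord_vec_eq_coord_tangent: "coord_vec A c i p = coord_tangent A c p (axis i 1)"
  by (simp add: coord_vec_def coord_tangent_def)

context smooth_manifold
begin

lemma charts_atD: "c \<in> charts_at A p \<Longrightarrow> c \<in> A" "c \<in> charts_at A p \<Longrightarrow> p \<in> chart_dom c"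
  by (simp_all add: charts_at_def)

lemma chart_at_in: "p \<in> topspace M \<Longrightarrow> chart_at A p \<in> charts_at A p"
  unfolding chart_at_def by (rule someI_ex) (auto simp: charts_cover charts_at_def)

lemma topspace_subtopology_chart_dom: "c \<in> A \<Longrightarrow> topspace (subtopology M (chart_dom c)) = chart_dom c"
  using openin_subset[OF open_dom] by (simp add: topspace_subtopology inf.absorb2)

lemma chart_dom_subset: "c \<in> A \<Longrightarrow> p \<in> chart_dom c \<Longrightarrow> p \<in> topspace M"
  using charts_cover by blast

lemma inj_on_chart_map: "c \<in> A \<Longrightarrow> inj_on (chart_map c) (chart_dom c)"
  using homeomorphic_imp_injective_map[OF chart_homeomorphic] topspace_subtopology_chart_dom by metis

lemma chart_inv_chart_map: "c \<in> A \<Longrightarrow> p \<in> chart_dom c \<Longrightarrow> chart_inv c (chart_map c p) = p"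
  unfolding chart_inv_def using inj_on_chart_map inv_into_f_f by metis

lemma chart_map_chart_inv: "x \<in> chart_img c \<Longrightarrow> chart_map c (chart_inv c x) = x"
  unfolding chart_inv_def by (rule f_inv_into_f)

lemma chart_inv_in_dom: "x \<in> chart_img c \<Longrightarrow> chart_inv c x \<in> chart_dom c"
  unfolding chart_inv_def by (rule inv_into_into)

lemma chart_inv_charts_at: "c \<in> A \<Longrightarrow> x \<in> chart_img c \<Longrightarrow> c \<in> charts_at A (chart_inv c x)"
  by (simp add: charts_at_def chart_inv_in_dom)

lemma openin_chart_preimage:
  assumes "c \<in> A" "open W"
  shows "openin M {p \<in> chart_dom c. chart_map c p \<in> W}"
proof -
  have "openin (subtopology M (chart_dom c))
      {p \<in> topspace (subtopology M (chart_dom c)). chart_map c p \<in> chart_img c \<inter> W}"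
    by (rule openin_continuous_map_preimage[OF homeomorphic_imp_continuous_map[OF chart_homeomorphic[OF assms(1)]]])
       (use assms(2) in \<open>auto intro: openin_open_Int\<close>)
  moreover have "{p \<in> topspace (subtopology M (chart_dom c)). chart_map c p \<in> chart_img c \<inter> W}
      = {p \<in> chart_dom c. chart_map c p \<in> W}"
    unfolding topspace_subtopology_chart_dom[OF assms(1)] by auto
  ultimately show ?thesis
    using openin_trans_full open_dom[OF assms(1)] by metis
qed

lemma open_chart_image:
  assumes "c \<in> A" "openin M V" "V \<subseteq> chart_dom c"
  shows "open (chart_map c ` V)"
proof -
  have "openin (subtopology M (chart_dom c)) V"
    using assms openin_open_subtopology open_dom by blast
  then have "openin (top_of_set (chart_img c)) (chart_map c ` V)"
    using homeomorphic_imp_open_map[OF chart_homeomorphic[OF assms(1)]] unfolding open_map_def by blast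
  then show ?thesis
    using open_img[OF assms(1)] openin_open_eq by blast
qed

lemma open_overlap:
  assumes "c \<in> A" "d \<in> A"
  shows "open (chart_map c ` (chart_dom c \<inter> chart_dom d))"
  using assms by (intro open_chart_image openin_Int open_dom) auto

lemma transition_chart_map: "c \<in> charts_at A p \<Longrightarrow> transition c d (chart_map c p) = chart_map d p"
  by (simp add: transition_def charts_at_def chart_inv_chart_map)

lemma chart_inv_overlap:
  assumes "c \<in> A" "d \<in> A" "x \<in> chart_map c ` (chart_dom c \<inter> chart_dom d)"
  shows "chart_inv c x = chart_inv d (transition c d x)"
  using assms by (auto simp: transition_def chart_inv_chart_map)

lemma has_derivative_transition:
  assumes "c \<in> charts_at A p" "d \<in> charts_at A p"
  shows "(transition c d has_derivative frechet_derivative (transition c d) (at (chart_map c p))) (at (chart_map c p))"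
  using assms by (intro smooth_on_has_derivative[OF smooth_transition]) (auto simp: charts_at_def)

text \<open>The chain rule on the overlap. Values in a general normed space allow \<open>u\<close>
  to be another chart map, which gives the cocycle rule for Jacobians of transitions.\<close>

lemma frechet_derivative_change_chart:
  fixes u :: "'a \<Rightarrow> 'b::real_normed_vector"
  assumes c: "c \<in> charts_at A p" and d: "d \<in> charts_at A p"
    and u: "(u \<circ> chart_inv d) differentiable (at (chart_map d p))"
  shows "frechet_derivative (u \<circ> chart_inv c) (at (chart_map c p)) v =
    frechet_derivative (u \<circ> chart_inv d) (at (chart_map d p))
      (frechet_derivative (transition c d) (at (chart_map c p)) v)"
proof -
  note A = charts_atD[OF c] charts_atD[OF d]
  have "frechet_derivative (u \<circ> chart_inv c) (at (chart_map c p)) = (\<lambda>v. frechet_derivative (u \<circ> chart_inv d) (at (chart_map d p))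
      (frechet_derivative (transition c d) (at (chart_map c p)) v))"
  proof (rule frechet_derivative_compose_open(2)[OF open_overlap[OF A(1,3)],
        where f = "u \<circ> chart_inv d" and g = "transition c d"
          and g' = "frechet_derivative (transition c d) (at (chart_map c p))"])
    show "chart_map c p \<in> chart_map c ` (chart_dom c \<inter> chart_dom d)"
      using A by blast
    show "(u \<circ> chart_inv c) y = (u \<circ> chart_inv d) (transition c d y)"
      if "y \<in> chart_map c ` (chart_dom c \<inter> chart_dom d)" for y
      using chart_inv_overlap[OF A(1,3) that] by simp
    show "((u \<circ> chart_inv d) has_derivative frechet_derivative (u \<circ> chart_inv d) (at (chart_map d p)))
        (at (transition c d (chart_map c p)))"
      using u by (simp add: transition_chart_map[OF c] frechet_derivative_works)
  qed (rule has_derivative_transition[OF c d])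
  then show ?thesis by simp
qed

lemma frechet_derivative_transition_compose:
  assumes "c \<in> charts_at A p" "d \<in> charts_at A p" "e \<in> charts_at A p"
  shows "frechet_derivative (transition c e) (at (chart_map c p)) v =
    frechet_derivative (transition d e) (at (chart_map d p))
      (frechet_derivative (transition c d) (at (chart_map c p)) v)"
  using frechet_derivative_change_chart[OF assms(1,2), of "chart_map e" v] has_derivative_transition[OF assms(2,3)]
  by (auto simp: transition_def differentiable_def)

lemma frechet_derivative_transition_refl:
  assumes "c \<in> charts_at A p"
  shows "frechet_derivative (transition c c) (at (chart_map c p)) = (\<lambda>v. v)"
proof -
  note A = charts_atD[OF assms]
  have "((\<lambda>x. x) has_derivative (\<lambda>v. v)) (at (chart_map c p))"
    by (rule has_derivative_ident)
  then have "(transition c c has_derivative (\<lambda>v. v)) (at (chart_map c p))"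
    by (rule has_derivative_transform_within_open[OF _ open_img[OF A(1)]])
       (use A chart_map_chart_inv in \<open>auto simp: transition_def chart_inv_chart_map\<close>)
  then show ?thesis
    using frechet_derivative_at by metis
qed

lemma linear_transition:
  "c \<in> charts_at A p \<Longrightarrow> d \<in> charts_at A p \<Longrightarrow> linear (frechet_derivative (transition c d) (at (chart_map c p)))"
  using has_derivative_transition has_derivative_linear by blast

section \<open>Tangent vectors and differentials in coordinates\<close>

lemma coord_tangent_in_tangent_space:
  assumes "c \<in> charts_at A p"
  shows "coord_tangent A c p a \<in> tangent_space A p"
  by (auto simp: tangent_space_def coord_tangent_def intro: frechet_derivative_transition_compose[OF assms])

lemma coord_tangent_self: "c \<in> charts_at A p \<Longrightarrow> coord_tangent A c p a c = a"
  by (simp add: coord_tangent_def frechet_derivative_transition_refl)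

lemma tangent_space_change_chart:
  assumes "v \<in> tangent_space A p" "c \<in> charts_at A p" "d \<in> charts_at A p"
  shows "v d = frechet_derivative (transition c d) (at (chart_map c p)) (v c)"
  using assms unfolding tangent_space_def by blast

text \<open>Equality holds also at charts away from \<open>p\<close>, thanks to the convention that
  a tangent vector is 0 there.\<close>

lemma coord_tangent_of_tangent:
  assumes "c \<in> charts_at A p" "v \<in> tangent_space A p"
  shows "coord_tangent A c p (v c) = v"
proof
  fix d
  show "coord_tangent A c p (v c) d = v d"
  proof (cases "d \<in> charts_at A p")
    case True
    then show ?thesis
      unfolding coord_tangent_def tangent_space_change_chart[OF assms(2,1) True] by simp
  next
    case False
    then have "v d = 0"
      using assms(2) unfolding tangent_space_def by blast
    then show ?thesis
      using False by (simp add: coord_tangent_def)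
  qed
qed

lemma coord_tangent_change_chart:
  assumes "c \<in> charts_at A p" "d \<in> charts_at A p"
  shows "coord_tangent A c p a = coord_tangent A d p (frechet_derivative (transition c d) (at (chart_map c p)) a)"
  by (auto simp: coord_tangent_def fun_eq_iff intro: frechet_derivative_transition_compose[OF assms])

lemma coord_tangent_linear:
  assumes "c \<in> charts_at A p"
  shows "coord_tangent A c p (r *\<^sub>R a + s *\<^sub>R b) = (\<lambda>d. r *\<^sub>R coord_tangent A c p a d + s *\<^sub>R coord_tangent A c p b d)"
  unfolding coord_tangent_def
  using linear_transition[OF assms] by (auto simp: linear_add linear_cmul)

lemma differential_chart:
  assumes "c \<in> charts_at A p" "smooth_fun A u" "v \<in> tangent_space A p"
  shows "differential A u p v = frechet_derivative (u \<circ> chart_inv c) (at (chart_map c p)) (v c)"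
proof -
  define d where "d = chart_at A p"
  have d: "d \<in> charts_at A p"
    unfolding d_def using chart_at_in chart_dom_subset charts_atD[OF assms(1)] by blast
  have "smooth_on (chart_img d) (u \<circ> chart_inv d)"
    using assms(2) charts_atD[OF d] by (simp add: smooth_fun_def)
  then have "(u \<circ> chart_inv d) differentiable (at (chart_map d p))"
    using smooth_on_has_derivative charts_atD[OF d] unfolding differentiable_def by blast
  from frechet_derivative_change_chart[OF assms(1) d this]
  show ?thesis
    unfolding differential_def d_def[symmetric] Let_def tangent_space_change_chart[OF assms(3,1) d] by simp
qed

end


section \<open>Metric and gradient in coordinates\<close>

context riemannian_manifold
begin

text \<open>Linearity is given in the first argument only; symmetry carries the expansion in the
  coordinate basis over to the second.\<close>

lemma metric_coord:
  assumes c: "c \<in> charts_at A p"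
  shows "g p (coord_tangent A c p a) (coord_tangent A c p b) = a \<bullet> (metric_matrix A g c (chart_map c p) *v b)"
proof -
  define T where "T = coord_tangent A c p"
  define G where "G = metric_matrix A g c (chart_map c p)"
  have p: "p \<in> topspace M"
    using charts_atD[OF c] chart_dom_subset by blast
  have T: "T x \<in> tangent_space A p" for x
    unfolding T_def by (rule coord_tangent_in_tangent_space[OF c])
  have lin: "linear (\<lambda>x. g p (T x) (T y))" for y
  proof (rule linearI)
    show "g p (T (x + x')) (T y) = g p (T x) (T y) + g p (T x') (T y)" for x x'
      using metric_linear[OF p T T T, of 1 x 1 x' y] coord_tangent_linear[OF c, of 1 x 1 x'] by (simp add: T_def)
    show "g p (T (r *\<^sub>R x)) (T y) = r *\<^sub>R g p (T x) (T y)" for r x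
      using metric_linear[OF p T T T, of r x 0 x y] coord_tangent_linear[OF c, of r x 0 x] by (simp add: T_def)
  qed
  \<comment> \<open>A linear functional is its own derivative, so the expansion of a derivative in
    partial derivatives is its expansion in the standard basis.\<close>
  have expand: "f x = (\<Sum>i\<in>UNIV. x $ i * f (axis i 1))" if "linear f" for f :: "real^'n \<Rightarrow> real" and x
    using has_derivative_pderiv_at(1)[OF linear_imp_has_derivative[OF that, of "at 0"], of x]
    by (simp add: has_derivative_pderiv_at(2)[OF linear_imp_has_derivative[OF that, of "at 0"]])
  have Gij: "g p (T (axis i 1)) (T (axis j 1)) = G $ i $ j" for i j
    using charts_atD[OF c]
    by (simp add: G_def T_def metric_matrix_def chart_inv_chart_map coord_vec_eq_coord_tangent)
  have metric_sym_G: "G $ i $ j = G $ j $ i" for i j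
    unfolding Gij[symmetric] by (rule metric_sym[OF p T T])
  have bG: "b $ j * g p (T (axis j 1)) (T (axis i 1)) = G $ i $ j * b $ j" for i j
    by (simp add: Gij metric_sym_G[of j i])
  have "g p (T a) (T b) = (\<Sum>i\<in>UNIV. a $ i * g p (T (axis i 1)) (T b))"
    by (rule expand[OF lin])
  also have "\<dots> = (\<Sum>i\<in>UNIV. a $ i * g p (T b) (T (axis i 1)))"
    using metric_sym[OF p T T] by simp
  also have "\<dots> = (\<Sum>i\<in>UNIV. a $ i * (\<Sum>j\<in>UNIV. b $ j * g p (T (axis j 1)) (T (axis i 1))))"
    by (simp only: expand[OF lin, where x = b])
  also have "\<dots> = (\<Sum>i\<in>UNIV. a $ i * (\<Sum>j\<in>UNIV. G $ i $ j * b $ j))"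
    by (simp only: bG)
  also have "\<dots> = a \<bullet> (G *v b)"
    by (simp add: inner_vec_def matrix_vector_mult_def)
  finally show ?thesis
    by (simp add: T_def G_def)
qed

lemma metric_matrix_sym:
  assumes "c \<in> charts_at A p"
  shows "metric_matrix A g c (chart_map c p) $ i $ j = metric_matrix A g c (chart_map c p) $ j $ i"
  using metric_sym[OF chart_dom_subset[OF charts_atD[OF assms]] coord_tangent_in_tangent_space[OF assms]
      coord_tangent_in_tangent_space[OF assms]] charts_atD[OF assms]
  by (simp add: metric_matrix_def chart_inv_chart_map coord_vec_eq_coord_tangent)

lemma metric_matrix_pos:
  assumes c: "c \<in> charts_at A p" and "a \<noteq> 0"
  shows "0 < a \<bullet> (metric_matrix A g c (chart_map c p) *v a)"
proof -
  have "coord_tangent A c p a \<noteq> (\<lambda>d. 0)"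
    using coord_tangent_self[OF c, of a] \<open>a \<noteq> 0\<close> by (metis)
  then show ?thesis
    using metric_pos[OF chart_dom_subset[OF charts_atD[OF c]] coord_tangent_in_tangent_space[OF c]]
    by (metis metric_coord[OF c])
qed

lemma invertible_metric_matrix:
  assumes "c \<in> charts_at A p"
  shows "invertible (metric_matrix A g c (chart_map c p))"
proof -
  have "a = 0" if "metric_matrix A g c (chart_map c p) *v a = 0" for a
    using metric_matrix_pos[OF assms, of a] that by force
  then show ?thesis
    using matrix_left_invertible_ker invertible_left_inverse by blast
qed

text \<open>Both matrices represent the same bilinear form on the tangent space, and components
  change by \<open>J\<close>; testing against all \<open>a\<close> and \<open>b\<close> gives the
  matrix identity.\<close>

lemma metric_matrix_change_chart:
  assumes c: "c \<in> charts_at A p" and d: "d \<in> charts_at A p"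
  defines "J \<equiv> matrix (frechet_derivative (transition c d) (at (chart_map c p)))"
  shows "metric_matrix A g c (chart_map c p) = transpose J ** metric_matrix A g d (chart_map d p) ** J"
proof -
  have J: "frechet_derivative (transition c d) (at (chart_map c p)) a = J *v a" for a
    unfolding J_def using linear_transition[OF c d] by (simp add: matrix_works linear_matrix_vector_mul_eq)
  have "a \<bullet> (metric_matrix A g c (chart_map c p) *v b) = a \<bullet> ((transpose J ** metric_matrix A g d (chart_map d p) ** J) *v b)" for a b
  proof -
    have "a \<bullet> (metric_matrix A g c (chart_map c p) *v b) = (J *v a) \<bullet> (metric_matrix A g d (chart_map d p) *v (J *v b))"
      using metric_coord[OF c, of a b] metric_coord[OF d, of "J *v a" "J *v b"]
      by (simp add: coord_tangent_change_chart[OF c d] J)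
    also have "\<dots> = a \<bullet> ((transpose J ** metric_matrix A g d (chart_map d p) ** J) *v b)"
      using dot_lmul_matrix[of a "transpose J"]
      by (simp only: vector_transpose_matrix matrix_vector_mul_assoc matrix_mul_assoc)
    finally show ?thesis .
  qed
  then show ?thesis
    unfolding matrix_eq by (metis vector_eq_rdot inner_commute)
qed

text \<open>The condition on the gradient reads \<open>G *v x = D\<close> in components, with
  \<open>D\<close> the vector of partial derivatives of \<open>u\<close>. Invertibility of the
  metric matrix gives existence and uniqueness, so the definite description denotes.\<close>

lemma gradient_coord:
  assumes c: "c \<in> charts_at A p" and u: "smooth_fun A u"
  shows "gradient A g u p = coord_tangent A c p
    (matrix_inv (metric_matrix A g c (chart_map c p)) *v (\<chi> i. pderiv_at i (u \<circ> chart_inv c) (chart_map c p)))"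
    (is "_ = coord_tangent A c p (matrix_inv ?G *v ?D)")
proof -
  have sm: "smooth_on (chart_img c) (u \<circ> chart_inv c)"
    using u charts_atD[OF c] by (simp add: smooth_fun_def)
  have du: "differential A u p w = ?D \<bullet> w c" if "w \<in> tangent_space A p" for w
    using differential_chart[OF c u that]
      has_derivative_pderiv_at(1)[OF smooth_on_has_derivative[OF sm imageI[OF charts_atD(2)[OF c]]]]
    by (simp add: inner_vec_def mult.commute)
  have gv: "g p v w = (?G *v v c) \<bullet> w c" if "v \<in> tangent_space A p" "w \<in> tangent_space A p" for v w
  proof -
    have "g p v w = g p w v"
      using metric_sym[OF chart_dom_subset[OF charts_atD[OF c]]] that by blast
    also have "\<dots> = w c \<bullet> (?G *v v c)"
      using metric_coord[OF c, of "w c" "v c"] coord_tangent_of_tangent[OF c] that by simp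
    finally show ?thesis by (simp add: inner_commute)
  qed
  show ?thesis
    unfolding gradient_def
  proof (rule the_equality)
    show "coord_tangent A c p (matrix_inv ?G *v ?D) \<in> tangent_space A p \<and>
      (\<forall>w\<in>tangent_space A p. g p (coord_tangent A c p (matrix_inv ?G *v ?D)) w = differential A u p w)"
      using coord_tangent_in_tangent_space[OF c]
      by (simp add: gv du coord_tangent_self[OF c] matrix_vector_mul_assoc
          matrix_inv_mult[OF invertible_metric_matrix[OF c]])
    show "v = coord_tangent A c p (matrix_inv ?G *v ?D)"
      if v: "v \<in> tangent_space A p \<and> (\<forall>w\<in>tangent_space A p. g p v w = differential A u p w)" for v
    proof -
      have "(?G *v v c) \<bullet> x = ?D \<bullet> x" for x
        using v gv du coord_tangent_in_tangent_space[OF c, of x] coord_tangent_self[OF c, of x] by metis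
      then have "?G *v v c = ?D"
        by (metis vector_eq_rdot)
      then have "v c = matrix_inv ?G *v ?D"
        using matrix_inv_mult(2)[OF invertible_metric_matrix[OF c]]
        by (metis matrix_vector_mul_assoc matrix_vector_mul_lid)
      then show ?thesis
        using coord_tangent_of_tangent[OF c] v by metis
    qed
  qed
qed

end


section \<open>Divergence in coordinates\<close>

text \<open>Exchanging \<open>i\<close> and \<open>l\<close> turns the third term into the first, so
  they cancel. With h the inverse metric and d its first derivatives of the metric, half of what
  remains is the derivative of log sqrt(det g) in direction \<open>k\<close>.\<close>

lemma christoffel_trace:
  fixes h :: "'n::finite \<Rightarrow> 'n \<Rightarrow> real" and d :: "'n \<Rightarrow> 'n \<Rightarrow> 'n \<Rightarrow> real"
  assumes h: "\<And>i j. h i j = h j i" and d: "\<And>i j k. d i j k = d i k j"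
  shows "(\<Sum>i\<in>UNIV. \<Sum>l\<in>UNIV. h i l * (d i k l + d k i l - d l i k)) = (\<Sum>i\<in>UNIV. \<Sum>l\<in>UNIV. h i l * d k i l)"
proof -
  have "(\<Sum>i\<in>UNIV. \<Sum>l\<in>UNIV. h i l * d l i k) = (\<Sum>l\<in>UNIV. \<Sum>i\<in>UNIV. h i l * d l i k)"
    by (rule sum.swap)
  also have "\<dots> = (\<Sum>i\<in>UNIV. \<Sum>l\<in>UNIV. h i l * d i k l)"
    by (intro sum.cong refl) (metis h d)
  finally show ?thesis
    by (simp add: algebra_simps sum.distrib sum_subtractf)
qed

context riemannian_manifold
begin

lemma metric_matrix_chart_img:
  assumes "c \<in> A" "x \<in> chart_img c"
  shows "metric_matrix A g c x $ i $ j = metric_matrix A g c x $ j $ i"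
    and "invertible (metric_matrix A g c x)"
    and "a \<noteq> 0 \<Longrightarrow> 0 < a \<bullet> (metric_matrix A g c x *v a)"
  using metric_matrix_sym[OF chart_inv_charts_at[OF assms], of i j]
    invertible_metric_matrix[OF chart_inv_charts_at[OF assms]]
    metric_matrix_pos[OF chart_inv_charts_at[OF assms], of a]
  unfolding chart_map_chart_inv[OF assms(2)] by blast+

lemma matrix_inv_metric_sym:
  assumes "c \<in> A" "x \<in> chart_img c"
  shows "matrix_inv (metric_matrix A g c x) $ i $ j = matrix_inv (metric_matrix A g c x) $ j $ i"
proof -
  define G where "G = metric_matrix A g c x"
  define H where "H = matrix_inv G"
  have GH: "G ** H = mat 1" "H ** G = mat 1"
    using matrix_inv_mult metric_matrix_chart_img(2)[OF assms] by (auto simp: G_def H_def)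
  have "transpose G = G"
    using metric_matrix_chart_img(1)[OF assms] by (simp add: transpose_def G_def vec_eq_iff)
  then have "transpose H ** G = mat 1"
    using GH(1) by (metis matrix_transpose_mul transpose_mat)
  then have "transpose H = H"
    using GH(1) by (metis matrix_mul_assoc matrix_mul_lid matrix_mul_rid)
  then have "transpose H $ i $ j = H $ i $ j" by simp
  then show ?thesis
    by (simp add: transpose_def G_def H_def)
qed

lemma metric_matrix_has_derivative:
  assumes "c \<in> A" "x \<in> chart_img c"
  shows "(metric_matrix A g c has_derivative
    (\<lambda>v. \<chi> i j. frechet_derivative (\<lambda>y. metric_matrix A g c y $ i $ j) (at x) v)) (at x)"
  unfolding has_derivative_vec_nth_iff
  using smooth_on_has_derivative[OF metric_smooth[OF assms(1)] assms(2)] by simp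

lemma pderiv_metric_matrix_sym:
  assumes "c \<in> A" "x \<in> chart_img c"
  shows "pderiv_at k (\<lambda>y. metric_matrix A g c y $ i $ j) x = pderiv_at k (\<lambda>y. metric_matrix A g c y $ j $ i) x"
proof (rule pderiv_at_cong[OF open_img[OF assms(1)] assms(2)])
  show "(\<lambda>y. metric_matrix A g c y $ i $ j) differentiable at x"
    using smooth_on_has_derivative[OF metric_smooth[OF assms(1)] assms(2)] unfolding differentiable_def by blast
qed (rule metric_matrix_chart_img(1)[OF assms(1)])

lemma sum_cov_deriv_eq:
  assumes "c \<in> A" "x \<in> chart_img c"
  shows "(\<Sum>i\<in>UNIV. cov_deriv A g c X i i x) = (\<Sum>i\<in>UNIV. pderiv_at i (\<lambda>y. X (chart_inv c y) c $ i) x)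
    + (\<Sum>k\<in>UNIV. X (chart_inv c x) c $ k * (\<Sum>i\<in>UNIV. \<Sum>l\<in>UNIV.
        matrix_inv (metric_matrix A g c x) $ i $ l * pderiv_at k (\<lambda>y. metric_matrix A g c y $ i $ l) x)) / 2"
proof -
  define h where "h i l = matrix_inv (metric_matrix A g c x) $ i $ l" for i l
  define d where "d k i l = pderiv_at k (\<lambda>y. metric_matrix A g c y $ i $ l) x" for k i l
  have *: "(\<Sum>i\<in>UNIV. christoffel A g c i i k x) = (\<Sum>i\<in>UNIV. \<Sum>l\<in>UNIV. h i l * d k i l) / 2" for k
  proof -
    have "(\<Sum>i\<in>UNIV. christoffel A g c i i k x) = (\<Sum>i\<in>UNIV. \<Sum>l\<in>UNIV. h i l * (d i k l + d k i l - d l i k)) / 2"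
      by (simp add: christoffel_def h_def d_def sum_divide_distrib)
    also have "(\<Sum>i\<in>UNIV. \<Sum>l\<in>UNIV. h i l * (d i k l + d k i l - d l i k)) = (\<Sum>i\<in>UNIV. \<Sum>l\<in>UNIV. h i l * d k i l)"
      by (rule christoffel_trace)
        (unfold h_def d_def, rule matrix_inv_metric_sym[OF assms], rule pderiv_metric_matrix_sym[OF assms])
    finally show ?thesis .
  qed
  have "(\<Sum>i\<in>UNIV. \<Sum>k\<in>UNIV. christoffel A g c i i k x * X (chart_inv c x) c $ k)
      = (\<Sum>k\<in>UNIV. (\<Sum>i\<in>UNIV. christoffel A g c i i k x) * X (chart_inv c x) c $ k)"
    by (subst sum.swap) (simp add: sum_distrib_right)
  also have "\<dots> = (\<Sum>k\<in>UNIV. X (chart_inv c x) c $ k * (\<Sum>i\<in>UNIV. \<Sum>l\<in>UNIV. h i l * d k i l)) / 2"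
    unfolding * by (subst sum_divide_distrib) (intro sum.cong refl, simp)
  finally show ?thesis
    by (simp add: cov_deriv_def sum.distrib h_def d_def)
qed

text \<open>The divergence in the matrix form to which
  \<open>coordinate_divergence_invariant\<close> applies; the sum over \<open>k\<close> becomes the
  derivative of the metric along the field.\<close>

lemma sum_cov_deriv_trace:
  assumes "c \<in> A" "x \<in> chart_img c"
    and X: "((\<lambda>y. X (chart_inv c y) c) has_derivative X') (at x)"
    and G: "(metric_matrix A g c has_derivative G') (at x)"
  shows "(\<Sum>i\<in>UNIV. cov_deriv A g c X i i x)
    = trace (matrix X') + trace (matrix_inv (metric_matrix A g c x) ** G' (X (chart_inv c x) c)) / 2"
proof -
  define h where "h i l = matrix_inv (metric_matrix A g c x) $ i $ l" for i l
  define d where "d k i l = pderiv_at k (\<lambda>y. metric_matrix A g c y $ i $ l) x" for k i l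
  define Z where "Z = X (chart_inv c x) c"
  have "pderiv_at i (\<lambda>y. X (chart_inv c y) c $ i) x = matrix X' $ i $ i" for i
    unfolding pderiv_at_def frechet_derivative_vec_nth[OF X] by (simp add: matrix_def)
  then have 1: "(\<Sum>i\<in>UNIV. pderiv_at i (\<lambda>y. X (chart_inv c y) c $ i) x) = trace (matrix X')"
    by (simp add: trace_def)
  have G': "G' Z $ l $ i = (\<Sum>k\<in>UNIV. Z $ k * d k i l)" for l i
  proof -
    have "((\<lambda>y. metric_matrix A g c y $ l $ i) has_derivative (\<lambda>v. G' v $ l $ i)) (at x)"
      by (intro bounded_linear.has_derivative[OF bounded_linear_vec_nth] G)
    from has_derivative_pderiv_at(1)[OF this, of Z] show ?thesis
      unfolding d_def pderiv_metric_matrix_sym[OF assms(1,2), of _ l i] .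
  qed
  have "trace (matrix_inv (metric_matrix A g c x) ** G' Z) = (\<Sum>i\<in>UNIV. \<Sum>l\<in>UNIV. \<Sum>k\<in>UNIV. Z $ k * (h i l * d k i l))"
    by (simp add: trace_def matrix_matrix_mult_def h_def[symmetric] G' sum_distrib_left algebra_simps)
  also have "\<dots> = (\<Sum>i\<in>UNIV. \<Sum>k\<in>UNIV. \<Sum>l\<in>UNIV. Z $ k * (h i l * d k i l))"
    by (intro sum.cong refl sum.swap)
  also have "\<dots> = (\<Sum>k\<in>UNIV. \<Sum>i\<in>UNIV. \<Sum>l\<in>UNIV. Z $ k * (h i l * d k i l))"
    by (rule sum.swap)
  finally have "trace (matrix_inv (metric_matrix A g c x) ** G' Z) = (\<Sum>k\<in>UNIV. Z $ k * (\<Sum>i\<in>UNIV. \<Sum>l\<in>UNIV. h i l * d k i l))"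
    by (simp add: sum_distrib_left)
  with 1 show ?thesis
    unfolding sum_cov_deriv_eq[OF assms(1,2)] by (simp add: h_def d_def Z_def)
qed

lemma sum_cov_deriv_change_chart:
  assumes c: "c \<in> charts_at A p" and d: "d \<in> charts_at A p"
    and X: "\<And>q. q \<in> topspace M \<Longrightarrow> X q \<in> tangent_space A q"
    and diff: "\<And>e x. e \<in> A \<Longrightarrow> x \<in> chart_img e \<Longrightarrow> (\<lambda>y. X (chart_inv e y) e) differentiable (at x)"
  shows "(\<Sum>i\<in>UNIV. cov_deriv A g c X i i (chart_map c p)) = (\<Sum>i\<in>UNIV. cov_deriv A g d X i i (chart_map d p))"
proof -
  note cA = charts_atD[OF c] and dA = charts_atD[OF d]
  define S where "S = chart_map c ` (chart_dom c \<inter> chart_dom d)"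
  define x where "x = chart_map c p"
  define \<phi> where "\<phi> = transition c d"
  define J where "J y = matrix (frechet_derivative \<phi> (at y))" for y
  \<comment> \<open>\<open>J' v\<close> sends \<open>w\<close> to the derivative of phi first along
    \<open>v\<close>, then along \<open>w\<close>, while the derivative of \<open>J\<close> along
    \<open>v\<close> takes them in the other order. Symmetry of second derivatives identifies the
    two.\<close>
  define J' where "J' v = matrix (frechet_derivative (\<lambda>y. frechet_derivative \<phi> (at y) v) (at x))" for v
  have S: "open S" "x \<in> S"
    using open_overlap[OF cA(1) dA(1)] cA dA by (auto simp: S_def x_def)
  have ximg: "x \<in> chart_img c" and dimg: "chart_map d p \<in> chart_img d"
    using cA dA by (auto simp: x_def)
  have sm: "smooth_on S \<phi>"
    unfolding S_def \<phi>_def by (rule smooth_transition[OF cA(1) dA(1)])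
  have \<phi>x: "\<phi> x = chart_map d p"
    unfolding \<phi>_def x_def by (rule transition_chart_map[OF c])
  have Jv: "J y *v v = frechet_derivative \<phi> (at y) v" if "y \<in> S" for y v
    unfolding J_def using has_derivative_linear[OF smooth_on_has_derivative[OF sm that]]
    by (simp add: matrix_works linear_matrix_vector_mul_eq)
  have sm2: "smooth_on S (\<lambda>y. frechet_derivative \<phi> (at y) v)" for v
    by (rule smooth_on_frechet_derivative[OF sm])
  have J'v: "J' v *v w = frechet_derivative (\<lambda>y. frechet_derivative \<phi> (at y) v) (at x) w" for v w
    unfolding J'_def using has_derivative_linear[OF smooth_on_has_derivative[OF sm2 S(2)]]
    by (simp add: matrix_works linear_matrix_vector_mul_eq)
  have sym: "J' v *v w = J' w *v v" for v w
    unfolding J'v by (rule symmetric_second_derivative[OF S(1) sm S(2)])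
  have \<phi>': "(\<phi> has_derivative (*v) (J x)) (at x)"
    using smooth_on_has_derivative[OF sm S(2)] unfolding ext[of "(*v) (J x)", OF Jv[OF S(2)]] .
  have J: "(J has_derivative J') (at x)"
    unfolding has_derivative_vec_nth_iff
  proof (intro allI)
    fix i j
    have "((\<lambda>y. frechet_derivative \<phi> (at y) (axis j 1) $ i) has_derivative
        (\<lambda>v. frechet_derivative (\<lambda>y. frechet_derivative \<phi> (at y) (axis j 1)) (at x) v $ i)) (at x)"
      by (rule bounded_linear.has_derivative[OF bounded_linear_vec_nth smooth_on_has_derivative[OF sm2 S(2)]])
    moreover have "frechet_derivative (\<lambda>y. frechet_derivative \<phi> (at y) (axis j 1)) (at x) v $ i = J' v $ i $ j" for v
      unfolding J'_def symmetric_second_derivative[OF S(1) sm S(2), of "axis j 1"] by (simp add: matrix_def)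
    ultimately show "((\<lambda>y. J y $ i $ j) has_derivative (\<lambda>v. J' v $ i $ j)) (at x)"
      by (simp add: J_def matrix_def)
  qed
  have inS: "\<exists>q. y = chart_map c q \<and> c \<in> charts_at A q \<and> d \<in> charts_at A q \<and>
      chart_inv c y = q \<and> \<phi> y = chart_map d q \<and> chart_inv d (\<phi> y) = q \<and> q \<in> topspace M" if "y \<in> S" for y
  proof -
    obtain q where q: "y = chart_map c q" "q \<in> chart_dom c" "q \<in> chart_dom d"
      using \<open>y \<in> S\<close> unfolding S_def by blast
    then have qc: "c \<in> charts_at A q" "d \<in> charts_at A q"
      using cA dA by (auto simp: charts_at_def)
    then have "\<phi> y = chart_map d q"
      unfolding \<phi>_def q(1) by (blast intro: transition_chart_map)
    then show ?thesis
      using q qc chart_inv_chart_map[OF cA(1) q(2)] chart_inv_chart_map[OF dA(1) q(3)]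
        chart_dom_subset[OF cA(1) q(2)] by metis
  qed
  obtain X' where X': "((\<lambda>y. X (chart_inv c y) c) has_derivative X') (at x)"
    using diff[OF cA(1) ximg] unfolding differentiable_def by blast
  obtain Y' where Y': "((\<lambda>y. X (chart_inv d y) d) has_derivative Y') (at (\<phi> x))"
    using diff[OF dA(1) dimg] unfolding differentiable_def \<phi>x by blast
  obtain G' where G': "(metric_matrix A g c has_derivative G') (at x)"
    using metric_matrix_has_derivative[OF cA(1) ximg] by blast
  obtain K' where K': "(metric_matrix A g d has_derivative K') (at (\<phi> x))"
    using metric_matrix_has_derivative[OF dA(1) dimg] unfolding \<phi>x by blast
  have GK: "metric_matrix A g c y = transpose (J y) ** metric_matrix A g d (\<phi> y) ** J y" if "y \<in> S" for y
    using inS[OF that] metric_matrix_change_chart unfolding J_def \<phi>_def by metis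
  have XY: "X (chart_inv d (\<phi> y)) d = J y *v X (chart_inv c y) c" if "y \<in> S" for y
    using inS[OF that] tangent_space_change_chart[OF X] unfolding Jv[OF that] unfolding \<phi>_def by metis
  \<comment> \<open>A kernel vector of the Jacobian would, by \<open>GK\<close>, be a kernel vector
    of the positive definite metric matrix.\<close>
  have "a = 0" if "J x *v a = 0" for a
  proof -
    have "metric_matrix A g c x *v a = 0"
      unfolding GK[OF S(2)] using that by (simp flip: matrix_vector_mul_assoc)
    then show ?thesis
      using metric_matrix_chart_img(3)[OF cA(1) ximg, of a] by force
  qed
  then have invJ: "invertible (J x)"
    using matrix_left_invertible_ker invertible_left_inverse by blast
  have "trace (matrix X') + trace (matrix_inv (metric_matrix A g c x) ** G' (X (chart_inv c x) c)) / 2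
      = trace (matrix Y') + trace (matrix_inv (metric_matrix A g d (\<phi> x)) ** K' (X (chart_inv d (\<phi> x)) d)) / 2"
    using coordinate_divergence_invariant[OF \<phi>' J sym X' Y' G' K' invJ _ S XY GK]
      metric_matrix_chart_img(2)[OF dA(1) dimg] by (simp add: \<phi>x)
  moreover have "\<phi> x \<in> chart_img d"
    using dimg unfolding \<phi>x .
  ultimately show ?thesis
    using sum_cov_deriv_trace[where X = X, OF cA(1) ximg X' G'] sum_cov_deriv_trace[where X = X, OF dA(1) _ Y' K']
    unfolding x_def[symmetric] \<phi>x[symmetric] by linarith
qed

text \<open>Frees the divergence from the arbitrary choice of \<open>chart_at\<close>.
  Differentiability is asked for in every chart because nothing is known about the chosen
  one.\<close>

lemma divergence_chart:
  assumes "c \<in> charts_at A p"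
    and "\<And>q. q \<in> topspace M \<Longrightarrow> X q \<in> tangent_space A q"
    and "\<And>e x. e \<in> A \<Longrightarrow> x \<in> chart_img e \<Longrightarrow> (\<lambda>y. X (chart_inv e y) e) differentiable (at x)"
  shows "divergence A g X p = (\<Sum>i\<in>UNIV. cov_deriv A g c X i i (chart_map c p))"
  unfolding divergence_def Let_def
  using assms chart_at_in chart_dom_subset charts_atD[OF assms(1)] by (intro sum_cov_deriv_change_chart) auto

end


section \<open>The weighted Laplacian\<close>

definition weighted_laplacian ::
  "('a, 'n::finite) chart set \<Rightarrow> ('a, 'n) metric \<Rightarrow> ('a \<Rightarrow> real) \<Rightarrow> ('a \<Rightarrow> real) \<Rightarrow> 'a \<Rightarrow> real" where
  "weighted_laplacian A g f u = divergence A g (scale_field f (gradient A g u))"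

lemma laplacian_eq_weighted: "laplacian A g = weighted_laplacian A g (\<lambda>p. 1)"
  by (simp add: fun_eq_iff laplacian_def weighted_laplacian_def scale_field_def)

context riemannian_manifold
begin

definition second_order_coeff :: "('a \<Rightarrow> real) \<Rightarrow> ('a, 'n) chart \<Rightarrow> 'n \<Rightarrow> 'n \<Rightarrow> real^'n \<Rightarrow> real" where
  "second_order_coeff f c i j x = f (chart_inv c x) * matrix_inv (metric_matrix A g c x) $ i $ j"

text \<open>Classically (1 / sqrt(det g)) times the sum over i of the i-th partial of sqrt(det g) f
  g^{ij}, with the logarithmic derivative of the density written as half a trace. The factor
  \<open>1 / 2\<close> keeps it a product for the smoothness rules.\<close>

definition first_order_coeff :: "('a \<Rightarrow> real) \<Rightarrow> ('a, 'n) chart \<Rightarrow> 'n \<Rightarrow> real^'n \<Rightarrow> real" where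
  "first_order_coeff f c j x = (\<Sum>i\<in>UNIV. pderiv_at i (second_order_coeff f c i j) x) +
     (\<Sum>k\<in>UNIV. second_order_coeff f c k j x * (\<Sum>i\<in>UNIV. \<Sum>l\<in>UNIV.
        matrix_inv (metric_matrix A g c x) $ i $ l * pderiv_at k (\<lambda>y. metric_matrix A g c y $ i $ l) x)) * (1 / 2)"

lemma smooth_fun_chart: "smooth_fun A u \<Longrightarrow> c \<in> A \<Longrightarrow> smooth_on (chart_img c) (\<lambda>x. u (chart_inv c x))"
  by (simp add: smooth_fun_def comp_def)

lemma smooth_on_metric_inv:
  "c \<in> A \<Longrightarrow> smooth_on (chart_img c) (\<lambda>x. matrix_inv (metric_matrix A g c x) $ i $ j)"
  by (rule smooth_on_matrix_inv[OF open_img metric_smooth metric_matrix_chart_img(2)])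

lemma smooth_on_second_order_coeff:
  assumes "smooth_fun A f" "c \<in> A"
  shows "smooth_on (chart_img c) (second_order_coeff f c i j)"
  unfolding second_order_coeff_def[abs_def] using assms
  by (intro smooth_on_mult open_img smooth_fun_chart smooth_on_metric_inv)

lemma smooth_on_first_order_coeff:
  assumes "smooth_fun A f" "c \<in> A"
  shows "smooth_on (chart_img c) (first_order_coeff f c j)"
  unfolding first_order_coeff_def[abs_def]
  by (intro smooth_on_add smooth_on_mult smooth_on_sum smooth_on_const open_img assms
      smooth_on_second_order_coeff smooth_on_pderiv_at smooth_on_metric_inv metric_smooth)

lemma second_order_coeff_sym:
  "c \<in> A \<Longrightarrow> x \<in> chart_img c \<Longrightarrow> second_order_coeff f c i j x = second_order_coeff f c j i x"
  unfolding second_order_coeff_def by (metis matrix_inv_metric_sym)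

text \<open>For w = G^{-1} v one has v . G^{-1} v = w . G w, so the inverse metric inherits
  positivity; the weight \<open>f\<close> only scales it.\<close>

lemma second_order_coeff_pos:
  assumes "c \<in> A" "x \<in> chart_img c" "f (chart_inv c x) > 0" "v \<noteq> 0"
  shows "0 < (\<Sum>i\<in>UNIV. \<Sum>j\<in>UNIV. second_order_coeff f c i j x * v $ i * v $ j)"
proof -
  define G where "G = metric_matrix A g c x"
  define w where "w = matrix_inv G *v v"
  have "G *v w = v"
    using matrix_inv_mult(1)[OF metric_matrix_chart_img(2)[OF assms(1,2)]]
    by (simp add: w_def G_def matrix_vector_mul_assoc)
  with \<open>v \<noteq> 0\<close> have "w \<noteq> 0"
    by auto
  then have "0 < w \<bullet> v"
    using metric_matrix_chart_img(3)[OF assms(1,2), of w] \<open>G *v w = v\<close> by (simp add: G_def)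
  then have "0 < f (chart_inv c x) * (v \<bullet> (matrix_inv G *v v))"
    using assms(3) by (simp add: w_def inner_commute)
  also have "\<dots> = (\<Sum>i\<in>UNIV. \<Sum>j\<in>UNIV. second_order_coeff f c i j x * v $ i * v $ j)"
    by (simp add: inner_vec_def matrix_vector_mult_def second_order_coeff_def G_def sum_distrib_left mult_ac)
  finally show ?thesis .
qed

lemma scaled_gradient_coord:
  assumes c: "c \<in> A" and u: "smooth_fun A u" and x: "x \<in> chart_img c"
  shows "scale_field f (gradient A g u) (chart_inv c x) c $ i
    = (\<Sum>j\<in>UNIV. second_order_coeff f c i j x * pderiv_at j (\<lambda>y. u (chart_inv c y)) x)"
  unfolding scale_field_def gradient_coord[OF chart_inv_charts_at[OF c x] u]
    coord_tangent_self[OF chart_inv_charts_at[OF c x]] chart_map_chart_inv[OF x]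
  by (simp add: matrix_vector_mult_def second_order_coeff_def comp_def sum_distrib_left mult_ac)

text \<open>The divergence is computed in the fixed chart \<open>c\<close>, whatever
  \<open>chart_at\<close> chooses. The product rule splits off the second-order part, and its
  remainder joins the Christoffel terms in \<open>first_order_coeff\<close>; no term in
  \<open>u\<close> itself arises.\<close>

lemma weighted_laplacian_coord:
  assumes f: "smooth_fun A f" and u: "smooth_fun A u" and c: "c \<in> A" and x: "x \<in> chart_img c"
  shows "weighted_laplacian A g f u (chart_inv c x) =
    (\<Sum>i\<in>UNIV. \<Sum>j\<in>UNIV. second_order_coeff f c i j x * pderiv_at i (pderiv_at j (\<lambda>y. u (chart_inv c y))) x)
    + (\<Sum>j\<in>UNIV. first_order_coeff f c j x * pderiv_at j (\<lambda>y. u (chart_inv c y)) x)"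
proof -
  define X where "X = scale_field f (gradient A g u)"
  define D where "D c j = pderiv_at j (\<lambda>y. u (chart_inv c y))" for c :: "('a, 'n) chart" and j
  define V where "V c i y = (\<Sum>j\<in>UNIV. second_order_coeff f c i j y * D c j y)" for c :: "('a, 'n) chart" and i y
  define K where "K k = (\<Sum>i\<in>UNIV. \<Sum>l\<in>UNIV.
        matrix_inv (metric_matrix A g c x) $ i $ l * pderiv_at k (\<lambda>y. metric_matrix A g c y $ i $ l) x)" for k
  have XV: "X (chart_inv e y) e $ i = V e i y" if "e \<in> A" "y \<in> chart_img e" for e y i
    unfolding X_def V_def D_def by (rule scaled_gradient_coord[OF that(1) u that(2)])
  have smD: "smooth_on (chart_img e) (D e j)" if "e \<in> A" for e j
    unfolding D_def by (intro smooth_on_pderiv_at smooth_fun_chart u that)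
  have smV: "smooth_on (chart_img e) (V e i)" if "e \<in> A" for e i
    unfolding V_def[abs_def]
    by (intro smooth_on_sum smooth_on_mult smooth_on_second_order_coeff smD open_img f that)
  have smX: "smooth_on (chart_img e) (\<lambda>y. X (chart_inv e y) e $ i)" if "e \<in> A" for e i
    by (rule smooth_on_cong[OF open_img[OF that] smV[OF that]]) (simp only: XV[OF that])
  have diff: "(\<lambda>y. X (chart_inv e y) e) differentiable (at y)" if "e \<in> A" "y \<in> chart_img e" for e y
  proof -
    have "((\<lambda>y. X (chart_inv e y) e) has_derivative
        (\<lambda>v. \<chi> i. frechet_derivative (\<lambda>y. X (chart_inv e y) e $ i) (at y) v)) (at y)"
      unfolding has_derivative_vec_nth_iff using smooth_on_has_derivative[OF smX[OF that(1)] that(2)] by simp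
    then show ?thesis
      unfolding differentiable_def by blast
  qed
  have tan: "X q \<in> tangent_space A q" if "q \<in> topspace M" for q
  proof -
    define e where "e = chart_at A q"
    have e: "e \<in> charts_at A q"
      unfolding e_def by (rule chart_at_in[OF that])
    obtain a where a: "gradient A g u q = coord_tangent A e q a"
      using gradient_coord[OF e u] by blast
    have "X q = coord_tangent A e q (f q *\<^sub>R a)"
      using coord_tangent_linear[OF e, of "f q" a 0 a] by (simp add: X_def scale_field_def a)
    then show ?thesis
      using coord_tangent_in_tangent_space[OF e] by simp
  qed
  have "weighted_laplacian A g f u (chart_inv c x) = (\<Sum>i\<in>UNIV. cov_deriv A g c X i i x)"
    unfolding weighted_laplacian_def X_def[symmetric]
    using divergence_chart[OF chart_inv_charts_at[OF c x] tan diff] unfolding chart_map_chart_inv[OF x] .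
  also have "\<dots> = (\<Sum>i\<in>UNIV. pderiv_at i (\<lambda>y. X (chart_inv c y) c $ i) x) + (\<Sum>k\<in>UNIV. V c k x * K k) / 2"
    unfolding sum_cov_deriv_eq[OF c x] K_def XV[OF c x] ..
  also have "(\<Sum>i\<in>UNIV. pderiv_at i (\<lambda>y. X (chart_inv c y) c $ i) x)
      = (\<Sum>i\<in>UNIV. \<Sum>j\<in>UNIV. second_order_coeff f c i j x * pderiv_at i (D c j) x)
      + (\<Sum>j\<in>UNIV. (\<Sum>i\<in>UNIV. pderiv_at i (second_order_coeff f c i j) x) * D c j x)"
  proof -
    have "pderiv_at i (\<lambda>y. X (chart_inv c y) c $ i) x
        = (\<Sum>j\<in>UNIV. second_order_coeff f c i j x * pderiv_at i (D c j) x + pderiv_at i (second_order_coeff f c i j) x * D c j x)" for i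
    proof -
      have "pderiv_at i (\<lambda>y. X (chart_inv c y) c $ i) x = pderiv_at i (V c i) x"
      proof (rule pderiv_at_cong[OF open_img[OF c] x])
        show "(\<lambda>y. X (chart_inv c y) c $ i) differentiable at x"
          using smooth_on_has_derivative[OF smX[OF c] x] unfolding differentiable_def by blast
      qed (rule XV[OF c])
      moreover have "(V c i has_derivative (\<lambda>h. \<Sum>j\<in>UNIV. second_order_coeff f c i j x * frechet_derivative (D c j) (at x) h
          + frechet_derivative (second_order_coeff f c i j) (at x) h * D c j x)) (at x)"
        unfolding V_def[abs_def]
        by (intro has_derivative_sum has_derivative_mult smooth_on_has_derivative[OF _ x]
            smooth_on_second_order_coeff smD f c)
      ultimately show ?thesis
        by (simp add: has_derivative_pderiv_at(2)) (simp add: pderiv_at_def)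
    qed
    moreover have "(\<Sum>i\<in>UNIV. \<Sum>j\<in>UNIV. pderiv_at i (second_order_coeff f c i j) x * D c j x)
        = (\<Sum>j\<in>UNIV. (\<Sum>i\<in>UNIV. pderiv_at i (second_order_coeff f c i j) x) * D c j x)"
      by (subst sum.swap) (simp add: sum_distrib_right)
    ultimately show ?thesis
      by (simp add: sum.distrib)
  qed
  also have "(\<Sum>k\<in>UNIV. V c k x * K k) / 2 = (\<Sum>j\<in>UNIV. (\<Sum>k\<in>UNIV. second_order_coeff f c k j x * K k) * (1 / 2) * D c j x)"
  proof -
    have "(\<Sum>k\<in>UNIV. V c k x * K k) = (\<Sum>k\<in>UNIV. \<Sum>j\<in>UNIV. second_order_coeff f c k j x * K k * D c j x)"
      unfolding V_def sum_distrib_right by (intro sum.cong refl) (simp only: mult_ac)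
    also have "\<dots> = (\<Sum>j\<in>UNIV. (\<Sum>k\<in>UNIV. second_order_coeff f c k j x * K k) * D c j x)"
      by (subst sum.swap) (simp add: sum_distrib_right)
    finally have VK: "(\<Sum>k\<in>UNIV. V c k x * K k) = \<dots>" .
    show ?thesis
      unfolding VK by (subst sum_divide_distrib) (intro sum.cong refl, simp)
  qed
  finally show ?thesis
    unfolding first_order_coeff_def K_def[symmetric] D_def[symmetric]
    by (simp add: distrib_right sum.distrib)
qed

text \<open>What makes iteration possible: in each chart the operator is one smooth expression, so
  its value is again an admissible argument.\<close>

lemma smooth_fun_weighted_laplacian:
  assumes "smooth_fun A f" "smooth_fun A u"
  shows "smooth_fun A (weighted_laplacian A g f u)"
  unfolding smooth_fun_def
proof
  fix c
  assume c: "c \<in> A"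
  have "smooth_on (chart_img c) (\<lambda>x. (\<Sum>i\<in>UNIV. \<Sum>j\<in>UNIV. second_order_coeff f c i j x * pderiv_at i (pderiv_at j (\<lambda>y. u (chart_inv c y))) x)
    + (\<Sum>j\<in>UNIV. first_order_coeff f c j x * pderiv_at j (\<lambda>y. u (chart_inv c y)) x))"
    by (intro smooth_on_add smooth_on_mult smooth_on_sum open_img smooth_on_second_order_coeff
        smooth_on_first_order_coeff smooth_on_pderiv_at smooth_fun_chart assms c)
  then show "smooth_on (chart_img c) (weighted_laplacian A g f u \<circ> chart_inv c)"
    by (rule smooth_on_cong[OF open_img[OF c]]) (simp only: comp_def weighted_laplacian_coord[OF assms c])
qed

lemma smooth_fun_uminus: "smooth_fun A u \<Longrightarrow> smooth_fun A (\<lambda>p. - u p)"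
  unfolding smooth_fun_def comp_def
  using smooth_on_bounded_linear[OF bounded_linear_minus[OF bounded_linear_ident] open_img] by blast

lemma weighted_laplacian_uminus:
  assumes f: "smooth_fun A f" and u: "smooth_fun A u" and p: "p \<in> topspace M"
  shows "weighted_laplacian A g f (\<lambda>p. - u p) p = - weighted_laplacian A g f u p"
proof -
  obtain c where c: "c \<in> A" "p \<in> chart_dom c"
    using p charts_cover by blast
  define x where "x = chart_map c p"
  define U where "U y = u (chart_inv c y)" for y
  have x: "x \<in> chart_img c" and p_eq: "chart_inv c x = p"
    using c chart_inv_chart_map by (simp_all add: x_def)
  have minus: "pderiv_at j (\<lambda>y. - F y) y = - pderiv_at j F y"
    if "smooth_on (chart_img c) F" "y \<in> chart_img c" for F j and y :: "real^'n"
    unfolding has_derivative_pderiv_at(2)[OF has_derivative_minus[OF smooth_on_has_derivative[OF that]]]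
    by (simp add: pderiv_at_def)
  have smU: "smooth_on (chart_img c) U"
    unfolding U_def by (rule smooth_fun_chart[OF u c(1)])
  have smU': "smooth_on (chart_img c) (\<lambda>y. - U y)"
    unfolding U_def by (rule smooth_fun_chart[OF smooth_fun_uminus[OF u] c(1)])
  have second: "pderiv_at i (pderiv_at j (\<lambda>y. - U y)) x = - pderiv_at i (pderiv_at j U) x" for i j
  proof -
    have "pderiv_at i (pderiv_at j (\<lambda>y. - U y)) x = pderiv_at i (\<lambda>y. - pderiv_at j U y) x"
    proof (rule pderiv_at_cong[OF open_img[OF c(1)] x])
      show "pderiv_at j (\<lambda>y. - U y) differentiable at x"
        using smooth_on_has_derivative[OF smooth_on_pderiv_at[OF smU'] x] unfolding differentiable_def by blast
    qed (rule minus[OF smU])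
    also have "\<dots> = - pderiv_at i (pderiv_at j U) x"
      by (rule minus[OF smooth_on_pderiv_at[OF smU] x])
    finally show ?thesis .
  qed
  have "weighted_laplacian A g f (\<lambda>p. - u p) (chart_inv c x) = - weighted_laplacian A g f u (chart_inv c x)"
    unfolding weighted_laplacian_coord[OF f smooth_fun_uminus[OF u] c(1) x] weighted_laplacian_coord[OF f u c(1) x]
      U_def[symmetric] second minus[OF smU x] by (simp add: sum_negf)
  then show ?thesis
    unfolding p_eq .
qed


section \<open>Functions on closed manifolds\<close>

lemma continuous_map_smooth_fun:
  assumes "smooth_fun A u"
  shows "continuous_map M euclideanreal u"
  unfolding continuous_map_def
proof (intro conjI allI impI)
  fix V :: "real set"
  assume "openin euclideanreal V"
  then have V: "open V" by simp
  define W where "W c = {x \<in> chart_img c. u (chart_inv c x) \<in> V}" for c :: "('a, 'n) chart"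
  have W: "open (W c)" if "c \<in> A" for c
    using continuous_open_preimage[OF smooth_on_continuous_on[OF smooth_fun_chart[OF assms that]] open_img[OF that] V]
    by (simp add: W_def vimage_def Int_def)
  have "{p \<in> topspace M. u p \<in> V} = (\<Union>c\<in>A. {p \<in> chart_dom c. chart_map c p \<in> W c})" (is "?L = ?R")
  proof
    show "?L \<subseteq> ?R"
    proof
      fix p
      assume p: "p \<in> ?L"
      then obtain c where c: "c \<in> A" "p \<in> chart_dom c"
        using charts_cover by blast
      then have "chart_map c p \<in> W c"
        using p by (simp add: W_def chart_inv_chart_map)
      with c show "p \<in> ?R" by blast
    qed
    show "?R \<subseteq> ?L"
    proof
      fix p
      assume "p \<in> ?R"
      then obtain c where c: "c \<in> A" "p \<in> chart_dom c" "chart_map c p \<in> W c"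
        by blast
      then show "p \<in> ?L"
        using chart_dom_subset[OF c(1,2)] by (simp add: W_def chart_inv_chart_map)
    qed
  qed
  then show "openin M {p \<in> topspace M. u p \<in> V}"
    using openin_chart_preimage[OF _ W] by (auto intro!: openin_Union)
qed auto

lemma subsolution_constant:
  assumes "compact_space M" "connected_space M"
    and f: "smooth_fun A f" "\<And>p. p \<in> topspace M \<Longrightarrow> f p > 0"
    and w: "smooth_fun A w" "\<And>p. p \<in> topspace M \<Longrightarrow> 0 \<le> weighted_laplacian A g f w p"
  shows "w constant_on topspace M"
proof (cases "topspace M = {}")
  case True
  then show ?thesis by (simp add: constant_on_def)
next
  case False
  have "compact (w ` topspace M)"
    using image_compactin[OF _ continuous_map_smooth_fun[OF w(1)]] assms(1)
    by (simp add: compact_space_def)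
  then obtain m where m: "m \<in> w ` topspace M" "\<And>p. p \<in> topspace M \<Longrightarrow> w p \<le> m"
    using compact_attains_sup[of "w ` topspace M"] False by auto
  define Z where "Z = {p \<in> topspace M. w p \<in> {m}}"
  have "closedin M Z"
    unfolding Z_def by (rule closedin_continuous_map_preimage[OF continuous_map_smooth_fun[OF w(1)]]) simp
  moreover have "openin M Z"
  proof (subst openin_subopen, rule ballI)
    fix p
    assume p: "p \<in> Z"
    then obtain c where c: "c \<in> A" "p \<in> chart_dom c"
      using charts_cover unfolding Z_def by blast
    define U where "U x = w (chart_inv c x)" for x
    have in_M: "chart_inv c x \<in> topspace M" if "x \<in> chart_img c" for x
      using chart_dom_subset[OF c(1) chart_inv_in_dom[OF that]] .
    have "\<exists>r>0. ball (chart_map c p) r \<subseteq> chart_img c \<and> (\<forall>x\<in>ball (chart_map c p) r. U x = m)"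
    proof (rule hopf_local[where a = "second_order_coeff f c" and b = "first_order_coeff f c"])
      show "0 \<le> (\<Sum>i\<in>UNIV. \<Sum>j\<in>UNIV. second_order_coeff f c i j x * pderiv_at i (pderiv_at j U) x)
          + (\<Sum>j\<in>UNIV. first_order_coeff f c j x * pderiv_at j U x)" if "x \<in> chart_img c" for x
        using w(2)[OF in_M[OF that]] unfolding weighted_laplacian_coord[OF f(1) w(1) c(1) that] U_def .
      show "0 < (\<Sum>i\<in>UNIV. \<Sum>j\<in>UNIV. second_order_coeff f c i j x * v $ i * v $ j)"
        if "x \<in> chart_img c" "v \<noteq> 0" for x v
        by (rule second_order_coeff_pos[where f = f, OF c(1) that(1) f(2)[OF in_M[OF that(1)]] that(2)])
      show "smooth_on (chart_img c) U"
        unfolding U_def by (rule smooth_fun_chart[OF w(1) c(1)])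
      show "U x \<le> m" if "x \<in> chart_img c" for x
        unfolding U_def by (rule m(2)[OF in_M[OF that]])
      show "U (chart_map c p) = m"
        using p c by (simp add: U_def Z_def chart_inv_chart_map)
      show "chart_map c p \<in> chart_img c"
        using c(2) by (rule imageI)
    qed (intro open_img second_order_coeff_sym smooth_on_continuous_on smooth_on_second_order_coeff
        smooth_on_first_order_coeff f c; assumption)+
    then obtain r where r: "r > 0" "\<And>x. x \<in> ball (chart_map c p) r \<Longrightarrow> U x = m"
      by blast
    show "\<exists>T. openin M T \<and> p \<in> T \<and> T \<subseteq> Z"
    proof (intro exI conjI)
      show "openin M {q \<in> chart_dom c. chart_map c q \<in> ball (chart_map c p) r}"
        by (rule openin_chart_preimage[OF c(1) open_ball])
      show "p \<in> {q \<in> chart_dom c. chart_map c q \<in> ball (chart_map c p) r}"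
        using c(2) r(1) by simp
      show "{q \<in> chart_dom c. chart_map c q \<in> ball (chart_map c p) r} \<subseteq> Z"
      proof
        fix q
        assume q: "q \<in> {q \<in> chart_dom c. chart_map c q \<in> ball (chart_map c p) r}"
        then have "q \<in> chart_dom c" "U (chart_map c q) = m"
          using r(2) by blast+
        then show "q \<in> Z"
          using chart_dom_subset[OF c(1)] by (simp add: Z_def U_def chart_inv_chart_map[OF c(1)])
      qed
    qed
  qed
  moreover have "Z \<noteq> {}"
    using m(1) by (auto simp: Z_def)
  ultimately have "Z = topspace M"
    using assms(2) unfolding connected_space_clopen_in by blast
  then show ?thesis
    unfolding constant_on_def Z_def by blast
qed

lemma one_signed_weighted_laplacian_constant:
  assumes "compact_space M" "connected_space M"
    and f: "smooth_fun A f" "\<And>p. p \<in> topspace M \<Longrightarrow> f p > 0"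
    and w: "smooth_fun A w"
    and sign: "(\<forall>p\<in>topspace M. 0 \<le> weighted_laplacian A g f w p) \<or>
               (\<forall>p\<in>topspace M. weighted_laplacian A g f w p \<le> 0)"
  shows "w constant_on topspace M"
  using sign
proof
  assume "\<forall>p\<in>topspace M. 0 \<le> weighted_laplacian A g f w p"
  then show ?thesis
    using subsolution_constant[OF assms(1-5)] by blast
next
  assume "\<forall>p\<in>topspace M. weighted_laplacian A g f w p \<le> 0"
  then have "(\<lambda>p. - w p) constant_on topspace M"
    by (intro subsolution_constant[OF assms(1-4) smooth_fun_uminus[OF w]]) (simp_all add: weighted_laplacian_uminus[OF f(1) w])
  then show ?thesis
    unfolding constant_on_def by (metis minus_minus)
qed

section \<open>Iterated Laplacians\<close>

lemma smooth_fun_const: "smooth_fun A (\<lambda>p. r)"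
  by (simp add: smooth_fun_def comp_def smooth_on_const)

lemma smooth_fun_mult: "smooth_fun A u \<Longrightarrow> smooth_fun A v \<Longrightarrow> smooth_fun A (\<lambda>p. u p * v p)"
  unfolding smooth_fun_def comp_def by (intro ballI smooth_on_mult open_img) auto

lemma smooth_fun_laplacian_power: "smooth_fun A u \<Longrightarrow> smooth_fun A ((laplacian A g ^^ s) u)"
  by (induction s) (simp_all add: laplacian_eq_weighted smooth_fun_weighted_laplacian smooth_fun_const)

lemma one_signed_laplacian_constant:
  assumes "compact_space M" "connected_space M" "smooth_fun A w"
    and "(\<forall>p\<in>topspace M. 0 \<le> laplacian A g w p) \<or> (\<forall>p\<in>topspace M. laplacian A g w p \<le> 0)"
  shows "w constant_on topspace M"
  using assms one_signed_weighted_laplacian_constant[OF assms(1,2) smooth_fun_const[of 1] _ assms(3)]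
  by (simp add: laplacian_eq_weighted)

text \<open>If the outermost Laplacian equals a constant \<open>r\<close>, it is one-signed whatever
  \<open>r\<close> is, so the function under it is constant and the induction descends.\<close>

lemma laplacian_power_constant:
  assumes "compact_space M" "connected_space M" "smooth_fun A w"
    and "(laplacian A g ^^ s) w constant_on topspace M"
  shows "w constant_on topspace M"
  using assms(4)
proof (induction s)
  case (Suc s)
  then obtain r where "\<And>p. p \<in> topspace M \<Longrightarrow> laplacian A g ((laplacian A g ^^ s) w) p = r"
    by (auto simp: constant_on_def)
  then have "(laplacian A g ^^ s) w constant_on topspace M"
    using assms(1-3) by (intro one_signed_laplacian_constant smooth_fun_laplacian_power) (cases "0 \<le> r"; simp)+
  then show ?case
    by (rule Suc.IH)
qed simp

end

theorem theorem6p2: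
  fixes M :: "'a topology"
    and A :: "('a, 'n::finite) chart set"
    and g :: "('a, 'n) metric"
    and f u :: "'a \<Rightarrow> real"
    and k :: nat
  assumes "riemannian_manifold M A g"
    and "compact_space M"
    and "connected_space M"
    and "smooth_fun A f"
    and "\<And>p. p \<in> topspace M \<Longrightarrow> f p > 0"
    and "k \<ge> 1"
    and "f_k_harmonic M A g f k u"
  shows "u constant_on topspace M"
proof -
  interpret riemannian_manifold M A g by fact
  define s where "s = k div 2"
  define w where "w = (laplacian A g ^^ s) u"
  have u: "smooth_fun A u"
    using assms(7) by (simp add: f_k_harmonic_def)
  then have w: "smooth_fun A w"
    unfolding w_def by (rule smooth_fun_laplacian_power)
  show ?thesis
  proof (cases "even k")
    case True
    \<comment> \<open>In the even case \<open>w\<close> is only known to be one-signed. As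
      \<open>s\<close> is at least 1, \<open>w\<close> is itself the Laplacian of a function, the
      iterate of order \<open>t\<close>, and that function is constant.\<close>
    with \<open>k \<ge> 1\<close> obtain t where t: "s = Suc t"
      unfolding s_def by (cases "k div 2") auto
    have "\<forall>p\<in>topspace M. (laplacian A g ^^ s) (\<lambda>q. f q * w q) p = 0"
      using assms(7) True by (simp add: f_k_harmonic_def s_def w_def Let_def)
    then have "(\<lambda>q. f q * w q) constant_on topspace M"
      by (intro laplacian_power_constant[OF assms(2,3) smooth_fun_mult[OF assms(4) w]]) (auto simp: constant_on_def)
    then obtain r where r: "\<And>p. p \<in> topspace M \<Longrightarrow> f p * w p = r"
      by (auto simp: constant_on_def)
    have "w p = r / f p" if "p \<in> topspace M" for p
      using r[OF that] assms(5)[OF that] by (simp add: field_simps)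
    then have "(\<forall>p\<in>topspace M. 0 \<le> w p) \<or> (\<forall>p\<in>topspace M. w p \<le> 0)"
      using assms(5) by (cases "0 \<le> r") (auto simp: less_imp_le divide_nonpos_pos)
    then have "(laplacian A g ^^ t) u constant_on topspace M"
      by (intro one_signed_laplacian_constant assms smooth_fun_laplacian_power u) (simp add: w_def t)
    then show ?thesis
      by (rule laplacian_power_constant[OF assms(2,3) u])
  next
    case False
    have "\<forall>p\<in>topspace M. (laplacian A g ^^ s) (weighted_laplacian A g f w) p = 0"
      using assms(7) False by (simp add: f_k_harmonic_def s_def w_def Let_def weighted_laplacian_def)
    then have "weighted_laplacian A g f w constant_on topspace M"
      by (intro laplacian_power_constant[OF assms(2,3) smooth_fun_weighted_laplacian[OF assms(4) w]])
        (auto simp: constant_on_def)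
    then obtain r where r: "\<And>p. p \<in> topspace M \<Longrightarrow> weighted_laplacian A g f w p = r"
      by (auto simp: constant_on_def)
    \<comment> \<open>Here the operator with weight \<open>f\<close> itself is one-signed, so the
      maximum principle applies to \<open>w\<close> with that weight before the Laplacians are
      removed.\<close>
    then have "w constant_on topspace M"
      by (intro one_signed_weighted_laplacian_constant[OF assms(2-5) w]) (cases "0 \<le> r"; simp)+
    then show ?thesis
      unfolding w_def by (rule laplacian_power_constant[OF assms(2,3) u])
  qed
qed

end
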